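(* Let $K$ be a finite extension of $\mathbb{Q}$ with ring of integers $\mathcal{O}_K$, let $\mathfrak{B}$ be a primitive collection of non-zero ideals in $\mathcal{O}_K$, let $(\mathfrak{S}_i)_{i\geq 1}$ be a saturated filtration of $\mathfrak{B}$ by finite collections of ideals, and put $\mathfrak{s}_i=\bigcap_{\mathfrak{b}\in\mathfrak{S}_i}\mathfrak{b}$. Then $$\mathcal{O}_K\setminus\bigcup_{\mathfrak{s}}\operatorname{Per}(\eta,\mathfrak{s})=\mathcal{M}_{\mathfrak{D}}\cap\mathcal{F}_{\mathfrak{B}}=\mathcal{O}_K\setminus\bigcup_{i\geq 1}\operatorname{Per}(\eta,\mathfrak{s}_i),$$ where the first union is over all non-zero ideals $\mathfrak{s}\subseteq\mathcal{O}_K$.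
   Context: A collection of ideals is primitive if $\mathfrak{b}\subseteq\mathfrak{b}'$ for members $\mathfrak{b},\mathfrak{b}'$ implies $\mathfrak{b}=\mathfrak{b}'$. For a collection $\mathfrak{A}$ of ideals put $\mathcal{M}_{\mathfrak{A}}=\bigcup_{\mathfrak{b}\in\mathfrak{A}}\mathfrak{b}$ and $\mathcal{F}_{\mathfrak{A}}=\mathcal{O}_K\setminus\mathcal{M}_{\mathfrak{A}}$. $\eta\in\{0,1\}^{\mathcal{O}_K}$ is the characteristic function of $\mathcal{F}_{\mathfrak{B}}$. For a non-zero ideal $\mathfrak{s}$, $\operatorname{Per}(\eta,\mathfrak{s})=\{g\in\mathcal{O}_K:\ \eta_{g+s}=\eta_g\text{ for all }s\in\mathfrak{s}\}$. A finite set $\mathfrak{S}\subseteq\mathfrak{B}$ is saturated if the only elements of $\mathfrak{B}$ containing $\bigcap_{\mathfrak{b}\in\mathfrak{S}}\mathfrak{b}$ are the elements of $\mathfrak{S}$; equivalently $\{\mathfrak{b}+\bigcap_{\mathfrak{b}'\in\mathfrak{S}}\mathfrak{b}':\mathfrak{b}\in\mathfrak{B}\}\cap\mathfrak{B}=\mathfrak{S}$ (the empty intersection is $\mathcal{O}_K$). A saturated filtration of $\mathfrak{B}$ by finite collections is a sequence $\mathfrak{S}_1\subseteq\mathfrak{S}_2\subseteq\cdots$ of finite saturated subsets of $\mathfrak{B}$ with $\bigcup_i\mathfrak{S}_i=\mathfrak{B}$. A collection $\mathcal{C}$ of ideals is pairwise coprime if $\mathfrak{c}+\mathfrak{c}'=\mathcal{O}_K$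 for all distinct $\mathfrak{c},\mathfrak{c}'\in\mathcal{C}$. $\mathfrak{D}$ is the set of all non-zero ideals $\mathfrak{d}\subseteq\mathcal{O}_K$ (possibly $\mathfrak{d}=\mathcal{O}_K$) such that $\{\mathfrak{d}\mathfrak{c}:\mathfrak{c}\in\mathcal{C}\}\subseteq\mathfrak{B}$ for some infinite pairwise coprime collection $\mathcal{C}$ of ideals in $\mathcal{O}_K$. *)

theory Defs
  imports
    "HOL-Algebra.Ideal_Product"
    "HOL-Computational_Algebra.Polynomial"
    "HOL-Library.Indicator_Function"
begin

text \<open>
  A number field is a type of class \<open>field_char_0\<close> that is finite-dimensional over its
  prime field, the scalar action of the rationals being \<open>q \<cdot> x = of_rat q * x\<close>.
\<close>

definition number_field :: "'k :: field_char_0 itself \<Rightarrow> bool" where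
  "number_field _ \<longleftrightarrow>
     (\<exists>Basis. finite_dimensional_vector_space (\<lambda>(q :: rat) (x :: 'k). of_rat q * x) Basis)"

definition ring_of_integers :: "'k :: field_char_0 ring" (\<open>\<O>\<close>) where
  "\<O> = \<lparr>carrier = {x. algebraic_int x}, monoid.mult = (*), one = 1, zero = 0, add = (+)\<rparr>"

definition nonzero_ideal :: "('a, 'm) ring_scheme \<Rightarrow> 'a set \<Rightarrow> bool" where
  "nonzero_ideal R I \<longleftrightarrow> ideal I R \<and> I \<noteq> {\<zero>\<^bsub>R\<^esub>}"

definition primitive :: "'a set set \<Rightarrow> bool" where
  "primitive \<AA> \<longleftrightarrow> (\<forall>\<bb>\<in>\<AA>. \<forall>\<bb>'\<in>\<AA>. \<bb> \<subseteq> \<bb>' \<longrightarrow> \<bb> = \<bb>')"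

definition multiples :: "'a set set \<Rightarrow> 'a set" where
  "multiples \<AA> = (\<Union>\<bb>\<in>\<AA>. \<bb>)"

definition free_elements :: "('a, 'm) ring_scheme \<Rightarrow> 'a set set \<Rightarrow> 'a set" where
  "free_elements R \<AA> = carrier R - multiples \<AA>"

definition eta :: "('a, 'm) ring_scheme \<Rightarrow> 'a set set \<Rightarrow> 'a \<Rightarrow> nat" where
  "eta R \<BB> = indicator (free_elements R \<BB>)"

definition Per :: "('a, 'm) ring_scheme \<Rightarrow> ('a \<Rightarrow> nat) \<Rightarrow> 'a set \<Rightarrow> 'a set" where
  "Per R \<eta> \<ss> = {g \<in> carrier R. \<forall>s\<in>\<ss>. \<eta> (g \<oplus>\<^bsub>R\<^esub> s) = \<eta> g}"

text \<open>Intersecting with the carrier only matters for the empty collection.\<close>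

definition ideal_Inter :: "('a, 'm) ring_scheme \<Rightarrow> 'a set set \<Rightarrow> 'a set" where
  "ideal_Inter R \<SS> = carrier R \<inter> (\<Inter>\<bb>\<in>\<SS>. \<bb>)"

definition saturated :: "('a, 'm) ring_scheme \<Rightarrow> 'a set set \<Rightarrow> 'a set set \<Rightarrow> bool" where
  "saturated R \<BB> \<SS> \<longleftrightarrow> finite \<SS> \<and> \<SS> \<subseteq> \<BB> \<and> {\<bb> \<in> \<BB>. ideal_Inter R \<SS> \<subseteq> \<bb>} = \<SS>"

text \<open>Filtrations are indexed from 1; the value at 0 is unconstrained.\<close>

definition saturated_filtration ::
  "('a, 'm) ring_scheme \<Rightarrow> 'a set set \<Rightarrow> (nat \<Rightarrow> 'a set set) \<Rightarrow> bool" where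
  "saturated_filtration R \<BB> \<SS> \<longleftrightarrow>
     (\<forall>i\<ge>1. saturated R \<BB> (\<SS> i)) \<and> (\<forall>i\<ge>1. \<SS> i \<subseteq> \<SS> (Suc i)) \<and> (\<Union>i\<in>{1..}. \<SS> i) = \<BB>"

definition pairwise_coprime :: "('a, 'm) ring_scheme \<Rightarrow> 'a set set \<Rightarrow> bool" where
  "pairwise_coprime R \<C> \<longleftrightarrow> pairwise (\<lambda>\<cc> \<cc>'. \<cc> <+>\<^bsub>R\<^esub> \<cc>' = carrier R) \<C>"

definition D_ideals :: "('a, 'm) ring_scheme \<Rightarrow> 'a set set \<Rightarrow> 'a set set" where
  "D_ideals R \<BB> =
     {\<dd>. nonzero_ideal R \<dd> \<and>
         (\<exists>\<C>. infinite \<C> \<and> (\<forall>\<cc>\<in>\<C>. ideal \<cc> R) \<and> pairwise_coprime R \<C> \<and>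
              {\<dd> \<cdot>\<^bsub>R\<^esub> \<cc> | \<cc>. \<cc> \<in> \<C>} \<subseteq> \<BB>)}"

end

theory Submission
  imports Defs "Jordan_Normal_Form.Char_Poly" "HOL-Computational_Algebra.Primes"
begin

text \<open>
  Fix a free element \<open>g\<close>. It fails to be \<open>\<ss>\<close>-periodic exactly when some member of \<open>\<BB>\<close> meets
  \<open>g + \<ss>\<close>. An element of \<open>\<M>\<^sub>\<BB>\<close>, on the other hand, is periodic for any member of \<open>\<BB>\<close> that contains it,
  and so for the intersection of a late stage of the filtration.

  If \<open>g\<close> lies in \<open>\<dd>\<close> with \<open>\<dd> \<cc>\<close> in \<open>\<BB>\<close> for infinitely many pairwise coprime \<open>\<cc>\<close>, then, for
  every nonzero \<open>\<ss>\<close>, some such \<open>\<cc>\<close> is coprime to \<open>\<ss>\<close>, because only finitely many ideals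
  contain \<open>\<ss>\<close>. Then \<open>\<dd> \<cc> + \<ss>\<close> contains \<open>\<dd>\<close>, and so \<open>g + \<ss>\<close> meets \<open>\<dd> \<cc>\<close>. This is \<open>not_period_of_D_multiple\<close>.

  Conversely, let \<open>g\<close> be nonperiodic for the intersections \<open>\<ss>\<^sub>i\<close> along the filtration, witnessed by
  members \<open>\<bb>\<^sub>i\<close> of \<open>\<BB>\<close> that meet \<open>g + \<ss>\<^sub>i\<close>. The ideals \<open>\<bb>\<^sub>i + \<ss>\<^sub>i\<close> all contain \<open>g \<noteq> 0\<close>, so infinitely many of
  them are one and the same ideal \<open>\<dd>\<close>. Once the filtration has absorbed \<open>\<bb>\<^sub>i\<close>, later \<open>\<ss>\<^sub>j\<close> are
  contained in \<open>\<bb>\<^sub>i\<close>, which forces \<open>\<bb>\<^sub>i + \<bb>\<^sub>j = \<dd>\<close>. Dividing by \<open>\<dd>\<close> gives infinitely many pairwise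
  coprime cofactors. This is \<open>nonperiodic_along_filtration\<close>. As the \<open>\<ss>\<^sub>i\<close> are nonzero ideals, these two
  inclusions give both equalities.

  Two facts about the ring of integers carry the argument. Only finitely many ideals contain a given
  nonzero element (\<open>finite_ideals_containing\<close>), because residue rings are finite; this follows from
  the bound on the dimension of the integers modulo a prime \<open>p\<close> by the degree of the field. And
  containment of nonzero ideals is divisibility with cancellation (\<open>ideal_contains_imp_divides\<close>,
  \<open>ideal_prod_cancel\<close>), which rests on invertibility (\<open>ideal_inverse\<close>). Invertibility is a
  consequence of the finiteness of residue rings and of integral closedness.
\<close>

section \<open>Algebraic integers form a ring\<close>

text \<open>
  Integrality of \<open>x\<close> is detected by a finitely generated additive group that \<open>x\<close> multiplies into
  itself. Such groups are spans for the scalar action of \<open>int\<close> on the field.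
\<close>

interpretation int_span: Modules.module "\<lambda>(c::int) (x::'k::field_char_0). of_int c * x"
  by unfold_locales (simp_all add: algebra_simps)

text \<open>
  The determinant trick: multiplication by \<open>x\<close> on the generators is given by an integer matrix, the
  column of generators is an eigenvector of it for the eigenvalue \<open>x\<close>, and so \<open>x\<close> is a root of the
  characteristic polynomial, which is monic with integer coefficients.
\<close>

lemma algebraic_int_if_stable:
  fixes x :: "'k :: field_char_0"
  assumes fin: "finite S" and s: "s \<in> S" "s \<noteq> 0"
    and stable: "\<And>y. y \<in> S \<Longrightarrow> x * y \<in> int_span.span S"
  shows "algebraic_int x"
proof -
  obtain ys where ys: "set ys = S" "distinct ys" using finite_distinct_list[OF fin] by blast
  define n where "n = length ys"
  have "\<forall>y\<in>S. \<exists>c. x * y = (\<Sum>z\<in>S. of_int (c z) * z)"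
    using stable unfolding int_span.span_finite[OF fin] by auto
  then obtain c where c: "\<And>y. y \<in> S \<Longrightarrow> x * y = (\<Sum>z\<in>S. of_int (c y z) * z)" by metis
  define A :: "int mat" where "A = mat n n (\<lambda>(i, j). c (ys ! i) (ys ! j))"
  define v where "v = vec n (\<lambda>i. ys ! i)"
  let ?A = "map_mat of_int A :: 'k mat"
  have A: "A \<in> carrier_mat n n" and A': "?A \<in> carrier_mat n n" by (auto simp: A_def)
  have sum_ys: "(\<Sum>z\<in>S. f z) = (\<Sum>j = 0..<n. f (ys ! j))" for f :: "'k \<Rightarrow> 'k"
    using sum.reindex_bij_betw[OF bij_betw_nth[OF ys(2) refl refl], of f]
    by (simp add: ys n_def atLeast0LessThan)
  have "?A *\<^sub>v v = x \<cdot>\<^sub>v v"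
  proof (rule eq_vecI)
    fix i assume "i < dim_vec (x \<cdot>\<^sub>v v)"
    then have i: "i < n" by (simp add: v_def)
    then have "ys ! i \<in> S" using ys by (auto simp: n_def)
    from c[OF this] show "(?A *\<^sub>v v) $ i = (x \<cdot>\<^sub>v v) $ i"
      using i by (simp add: sum_ys A_def v_def scalar_prod_def)
  qed (simp add: A_def v_def)
  moreover have "v \<noteq> 0\<^sub>v n"
  proof
    assume v: "v = 0\<^sub>v n"
    obtain i where "i < n" "ys ! i = s" using s ys by (metis in_set_conv_nth n_def)
    then show False using v s by (metis index_vec index_zero_vec(1) v_def)
  qed
  ultimately have "eigenvalue ?A x"
    unfolding eigenvalue_def eigenvector_def using A' by (auto simp: v_def intro!: exI[of _ v])
  then have "poly (map_poly of_int (char_poly A)) x = 0"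
    using eigenvalue_root_char_poly[OF A'] of_int_hom.char_poly_hom[OF A] by metis
  moreover have "lead_coeff (char_poly A) = 1" using degree_monic_char_poly[OF A] by simp
  ultimately show ?thesis unfolding algebraic_int_altdef_ipoly by blast
qed

lemma int_span_mult:
  fixes x :: "'k :: field_char_0"
  assumes "\<And>y. y \<in> T \<Longrightarrow> x * y \<in> int_span.span S" and "z \<in> int_span.span T"
  shows "x * z \<in> int_span.span S"
  using assms(2)
proof (induction rule: int_span.span_induct_alt)
  case base
  then show ?case by (simp add: int_span.span_zero)
next
  case (step c y z)
  then show ?case using int_span.span_add[OF int_span.span_scale[OF assms(1)[of y], of c]]
    by (simp add: algebra_simps)
qed

lemma monic_power_in_int_span:
  fixes x :: "'k :: field_char_0"
  assumes "lead_coeff p = 1" and "poly (map_poly of_int p) x = 0"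
  shows "x ^ degree p \<in> int_span.span ((\<lambda>i. x ^ i) ` {..<degree p})"
proof -
  have "0 = (\<Sum>i\<le>degree p. of_int (coeff p i) * x ^ i)"
    using assms(2) by (simp add: poly_altdef degree_map_poly coeff_map_poly)
  also have "\<dots> = (\<Sum>i<degree p. of_int (coeff p i) * x ^ i) + x ^ degree p"
    using assms(1) by (simp add: lessThan_Suc_atMost[symmetric])
  finally have "x ^ degree p = (\<Sum>i<degree p. of_int (- coeff p i) * x ^ i)"
    by (simp add: sum_negf eq_neg_iff_add_eq_0 add.commute)
  also have "\<dots> \<in> int_span.span ((\<lambda>i. x ^ i) ` {..<degree p})"
    by (intro int_span.span_sum int_span.span_scale int_span.span_base) auto
  finally show ?thesis .
qed

text \<open>
  The monomials \<open>x ^ i * y ^ j\<close> with exponents below the degrees of monic equations of \<open>x\<close> and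
  \<open>y\<close> span a group stable under both. The elements that preserve this group are closed under sums
  and products, which is how \<open>x + y\<close> and \<open>x * y\<close> become integral.
\<close>

lemma algebraic_int_common_stable:
  fixes x y :: "'k :: field_char_0"
  assumes "algebraic_int x" and "algebraic_int y"
  obtains S :: "'k set" where "finite S" "1 \<in> S"
    "\<And>z. z \<in> S \<Longrightarrow> x * z \<in> int_span.span S" "\<And>z. z \<in> S \<Longrightarrow> y * z \<in> int_span.span S"
proof -
  obtain p q where p: "poly (map_poly of_int p) x = 0" "lead_coeff p = 1"
    and q: "poly (map_poly of_int q) y = 0" "lead_coeff q = 1"
    using assms unfolding algebraic_int_altdef_ipoly by blast
  have pos: "degree p > 0" "degree q > 0"
    using p q by (auto intro!: Nat.gr0I elim!: degree_eq_zeroE)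
  define S where "S = (\<lambda>(i, j). x ^ i * y ^ j) ` ({..<degree p} \<times> {..<degree q})"
  have S: "x ^ i * y ^ j \<in> S" if "i < degree p" "j < degree q" for i j
    using that by (force simp: S_def)
  show thesis
  proof (rule that)
    show "finite S" "1 \<in> S" using S[of 0 0] pos by (auto simp: S_def)
    fix z assume "z \<in> S"
    then obtain i j where z: "z = x ^ i * y ^ j" "i < degree p" "j < degree q" by (auto simp: S_def)
    show "x * z \<in> int_span.span S"
    proof (cases "Suc i < degree p")
      case True
      then show ?thesis using int_span.span_base[OF S[OF True z(3)]] by (simp add: z mult.assoc)
    next
      case False
      then have "Suc i = degree p" using z by simp
      then have "x * z = y ^ j * x ^ degree p" using z by (metis mult.assoc mult.commute power_Suc)
      have "y ^ j * t \<in> int_span.span S" if "t \<in> (\<lambda>i. x ^ i) ` {..<degree p}" for t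
        using that S[OF _ z(3)] by (auto simp: mult.commute[of "y ^ j"] intro: int_span.span_base)
      from int_span_mult[OF this monic_power_in_int_span[OF p(2,1)]] show ?thesis
        unfolding \<open>x * z = y ^ j * x ^ degree p\<close> .
    qed
    show "y * z \<in> int_span.span S"
    proof (cases "Suc j < degree q")
      case True
      then show ?thesis using int_span.span_base[OF S[OF z(2) True]] by (simp add: z mult_ac)
    next
      case False
      then have "Suc j = degree q" using z by simp
      then have "y * z = x ^ i * y ^ degree q" using z by (metis mult.left_commute power_Suc)
      have "x ^ i * t \<in> int_span.span S" if "t \<in> (\<lambda>j. y ^ j) ` {..<degree q}" for t
        using that S[OF z(2)] by (auto intro: int_span.span_base)
      from int_span_mult[OF this monic_power_in_int_span[OF q(2,1)]] show ?thesis
        unfolding \<open>y * z = x ^ i * y ^ degree q\<close> .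
    qed
  qed
qed

lemma algebraic_int_add:
  fixes x y :: "'k :: field_char_0"
  assumes "algebraic_int x" and "algebraic_int y"
  shows "algebraic_int (x + y)"
proof -
  obtain S :: "'k set" where S: "finite S" "1 \<in> S"
    "\<And>z. z \<in> S \<Longrightarrow> x * z \<in> int_span.span S" "\<And>z. z \<in> S \<Longrightarrow> y * z \<in> int_span.span S"
    using algebraic_int_common_stable[OF assms] by blast
  show ?thesis
    by (rule algebraic_int_if_stable[OF S(1,2)])
      (auto simp: distrib_right intro: int_span.span_add S)
qed

lemma algebraic_int_mult:
  fixes x y :: "'k :: field_char_0"
  assumes "algebraic_int x" and "algebraic_int y"
  shows "algebraic_int (x * y)"
proof -
  obtain S :: "'k set" where S: "finite S" "1 \<in> S"
    "\<And>z. z \<in> S \<Longrightarrow> x * z \<in> int_span.span S" "\<And>z. z \<in> S \<Longrightarrow> y * z \<in> int_span.span S"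
    using algebraic_int_common_stable[OF assms] by blast
  show ?thesis
    by (rule algebraic_int_if_stable[OF S(1,2)])
      (auto simp: mult.assoc intro: int_span_mult[of S] S)
qed

lemma algebraic_int_diff:
  fixes x y :: "'k :: field_char_0"
  assumes "algebraic_int x" and "algebraic_int y"
  shows "algebraic_int (x - y)"
  using algebraic_int_add[OF assms(1), of "- y"] assms(2) by simp

lemma algebraic_int_power:
  fixes x :: "'k :: field_char_0"
  assumes "algebraic_int x" shows "algebraic_int (x ^ n)"
  by (induction n) (auto intro: algebraic_int_mult assms)

lemma algebraic_int_sum:
  fixes f :: "'b \<Rightarrow> 'k :: field_char_0"
  assumes "\<And>i. i \<in> A \<Longrightarrow> algebraic_int (f i)" shows "algebraic_int (sum f A)"
  using assms by (induction A rule: infinite_finite_induct) (auto intro: algebraic_int_add)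

section \<open>Finite residue rings\<close>

lemma common_denominator:
  fixes u :: "'b \<Rightarrow> rat"
  assumes "finite B"
  shows "\<exists>N::int. N \<noteq> 0 \<and> (\<forall>b\<in>B. \<exists>k::int. of_int N * u b = of_int k)"
  using assms
proof (induction B)
  case empty
  then show ?case by (intro exI[of _ 1]) simp
next
  case (insert x B)
  then obtain N :: int where N: "N \<noteq> 0" "\<forall>b\<in>B. \<exists>k::int. of_int N * u b = of_int k" by blast
  obtain a d where "quotient_of (u x) = (a, d)" by (cases "quotient_of (u x)") auto
  then have d: "d \<noteq> 0" "u x = of_int a / of_int d"
    using quotient_of_denom_pos[of "u x" a d] quotient_of_div[of "u x" a d] by auto
  have "\<exists>k::int. of_int (d * N) * u b = of_int k" if "b \<in> insert x B" for b
  proof (cases "b = x")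
    case True
    have "of_int (d * N) * u x = of_int (N * a)" using d by simp
    then show ?thesis using True by blast
  next
    case False
    then have "b \<in> B" using that by simp
    from bspec[OF N(2) this] obtain k :: int where "of_int N * u b = of_int k" ..
    then have "of_int (d * N) * u b = of_int (d * k)" by (simp only: of_int_mult mult.assoc)
    then show ?thesis by blast
  qed
  then show ?case using N(1) d(1) by (intro exI[of _ "d * N"]) auto
qed

text \<open>
  The only place where finite dimension over the rationals enters: the bound \<open>n\<close> is the degree of
  the number field, and a rational relation becomes an integral one after clearing denominators.
\<close>

lemma number_field_int_relation:
  assumes "number_field TYPE('k :: field_char_0)"
  obtains n where "\<And>B :: 'k set. \<lbrakk>finite B; card B > n\<rbrakk> \<Longrightarrow>
    \<exists>u :: 'k \<Rightarrow> int. (\<exists>b\<in>B. u b \<noteq> 0) \<and> (\<Sum>b\<in>B. of_int (u b) * b) = 0"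
proof -
  obtain Basis where
    "finite_dimensional_vector_space (\<lambda>(q :: rat) (x :: 'k). of_rat q * x) Basis"
    using assms unfolding number_field_def by blast
  then interpret V: finite_dimensional_vector_space "\<lambda>(q :: rat) (x :: 'k). of_rat q * x" Basis .
  show thesis
  proof (rule that)
    fix B :: "'k set" assume fin: "finite B" and card: "card B > V.dim UNIV"
    have "V.dependent B" using V.independent_card_le_dim[of B UNIV] card by auto
    then obtain u where u: "\<exists>b\<in>B. u b \<noteq> 0" "(\<Sum>b\<in>B. of_rat (u b) * b) = 0"
      using V.dependent_finite[OF fin] by auto
    obtain N :: int where N: "N \<noteq> 0" "\<forall>b\<in>B. \<exists>k::int. of_int N * u b = of_int k"
      using common_denominator[OF fin] by blast
    then obtain k :: "'k \<Rightarrow> int" where k: "\<And>b. b \<in> B \<Longrightarrow> of_int N * u b = of_int (k b)" by metis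
    have k': "of_int (k b) = (of_int N * of_rat (u b) :: 'k)" if "b \<in> B" for b
      using arg_cong[OF k[OF that], of "of_rat :: rat \<Rightarrow> 'k"] by (simp add: of_rat_mult)
    have "(\<Sum>b\<in>B. of_int (k b) * b) = of_int N * (\<Sum>b\<in>B. of_rat (u b) * b)"
      by (simp add: k' sum_distrib_left mult.assoc)
    moreover have "\<exists>b\<in>B. k b \<noteq> 0" using u(1) N(1) k by force
    ultimately show "\<exists>u :: 'k \<Rightarrow> int. (\<exists>b\<in>B. u b \<noteq> 0) \<and> (\<Sum>b\<in>B. of_int (u b) * b) = 0"
      using u(2) by auto
  qed
qed

text \<open>
  In characteristic zero a relation may be divided by the greatest common divisor of its
  coefficients; the result stays nontrivial modulo every non-unit.
\<close>

lemma primitive_int_relation: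
  fixes B :: "'k :: field_char_0 set" and u :: "'k \<Rightarrow> int"
  assumes "b \<in> B" "u b \<noteq> 0" and "(\<Sum>b\<in>B. of_int (u b) * b) = 0" and "\<not> is_unit p"
  shows "\<exists>w :: 'k \<Rightarrow> int. (\<exists>b\<in>B. \<not> p dvd w b) \<and> (\<Sum>b\<in>B. of_int (w b) * b) = 0"
proof -
  define g where "g = Gcd (u ` B)"
  define w where "w b = u b div g" for b
  have g0: "g \<noteq> 0" using assms(1,2) by (auto simp: g_def Gcd_0_iff)
  have u: "u b = g * w b" if "b \<in> B" for b using that by (simp add: w_def g_def)
  have "of_int g * (\<Sum>b\<in>B. of_int (w b) * b) = (\<Sum>b\<in>B. of_int (u b) * b)"
    unfolding sum_distrib_left by (rule sum.cong[OF refl]) (simp only: u of_int_mult mult.assoc)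
  then have "of_int g * (\<Sum>b\<in>B. of_int (w b) * b) = 0" unfolding assms(3) .
  moreover have "\<not> (\<forall>b\<in>B. p dvd w b)"
  proof
    assume p: "\<forall>b\<in>B. p dvd w b"
    have "p * g dvd u b" if "b \<in> B" for b
      using mult_dvd_mono[OF dvd_refl[of g] bspec[OF p that]] u[OF that] by (simp add: mult.commute)
    then have "p * g dvd Gcd (u ` B)" by (intro Gcd_greatest) blast
    then have "p * g dvd g" by (simp only: g_def)
    then show False using g0 assms(4) by (simp add: dvd_mult_cancel_right)
  qed
  ultimately show ?thesis using g0 by auto
qed

text \<open>
  Modulo \<open>p\<close> the integers of the field form a vector space over the field with \<open>p\<close> elements, and its
  dimension is at most the degree: a larger set satisfies a primitive integral relation, whose
  reduction modulo \<open>p\<close> is nontrivial. So representatives are found among the combinations of a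
  maximal independent set with coefficients from \<open>0\<close> to \<open>p - 1\<close>.
\<close>

lemma finite_residues_prime:
  assumes nf: "number_field TYPE('k :: field_char_0)" and p: "prime (p :: nat)"
  obtains F :: "'k :: field_char_0 set" where "finite F" "\<And>x. x \<in> F \<Longrightarrow> algebraic_int x"
    "\<And>x. algebraic_int x \<Longrightarrow> \<exists>y\<in>F. \<exists>z. algebraic_int z \<and> x - y = of_nat p * z"
proof -
  obtain n where n: "\<And>B :: 'k set. \<lbrakk>finite B; card B > n\<rbrakk> \<Longrightarrow>
    \<exists>u :: 'k \<Rightarrow> int. (\<exists>b\<in>B. u b \<noteq> 0) \<and> (\<Sum>b\<in>B. of_int (u b) * b) = 0"
    using number_field_int_relation[OF nf] by blast
  let ?P = "\<lambda>x. \<exists>z::'k. algebraic_int z \<and> x = of_nat p * z"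
  define indep where "indep B \<longleftrightarrow> finite B \<and> Ball B algebraic_int \<and>
    (\<forall>u :: 'k \<Rightarrow> int. ?P (\<Sum>b\<in>B. of_int (u b) * b) \<longrightarrow> (\<forall>b\<in>B. int p dvd u b))" for B
  have unit: "\<not> is_unit (int p)" using p by auto
  have bound: "card B \<le> n" if B: "indep B" for B
  proof (rule ccontr)
    assume "\<not> card B \<le> n"
    then obtain u :: "'k \<Rightarrow> int" where "\<exists>b\<in>B. u b \<noteq> 0" "(\<Sum>b\<in>B. of_int (u b) * b) = 0"
      using n[of B] B by (auto simp: indep_def)
    then obtain w :: "'k \<Rightarrow> int" where "\<exists>b\<in>B. \<not> int p dvd w b" "(\<Sum>b\<in>B. of_int (w b) * b) = 0"
      using primitive_int_relation[OF _ _ _ unit] by blast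
    moreover have "?P 0" by (intro exI[of _ 0]) simp
    ultimately show False using B by (auto simp: indep_def)
  qed
  have "indep {}" by (simp add: indep_def)
  then obtain B where B: "indep B" and max: "\<And>B'. indep B' \<Longrightarrow> card B' \<le> card B"
    using ex_has_greatest_nat[of indep "{}" card "Suc n"] bound by (metis le_imp_less_Suc)
  have fin: "finite B" and alg: "\<And>b. b \<in> B \<Longrightarrow> algebraic_int b"
    and ind: "\<And>u. ?P (\<Sum>b\<in>B. of_int (u b) * b) \<Longrightarrow> \<forall>b\<in>B. int p dvd u b"
    using B by (auto simp: indep_def)
  define F where "F = (\<lambda>c. \<Sum>b\<in>B. of_int (c b) * b) ` (B \<rightarrow>\<^sub>E {0..<int p})"
  have p0: "p > 0" using p by (simp add: prime_gt_0_nat)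
  \<comment> \<open>Coefficients only matter modulo \<open>p\<close>, so combinations with arbitrary coefficients suffice.\<close>
  have reduce: "\<exists>y\<in>F. ?P (x - y)" if x: "x = (\<Sum>b\<in>B. of_int (c b) * b) + of_nat p * z" "algebraic_int z"
    for x z :: 'k and c :: "'k \<Rightarrow> int"
  proof -
    let ?y = "\<Sum>b\<in>B. of_int (restrict (\<lambda>b. c b mod int p) B b) * b"
    have "x - ?y = (\<Sum>b\<in>B. (of_int (c b) - of_int (c b mod int p)) * b) + of_nat p * z"
      unfolding x(1) by (simp add: left_diff_distrib sum_subtractf)
    also have "\<dots> = (\<Sum>b\<in>B. (of_nat p * of_int (c b div int p)) * b) + of_nat p * z"
    proof -
      have "(of_int (c b) - of_int (c b mod int p) :: 'k) = of_int (int p * (c b div int p))" for b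
        by (metis minus_mod_eq_mult_div of_int_diff)
      then show ?thesis by simp
    qed
    also have "\<dots> = of_nat p * ((\<Sum>b\<in>B. of_int (c b div int p) * b) + z)"
      by (simp add: sum_distrib_left distrib_left mult.assoc)
    finally have "x - ?y = of_nat p * ((\<Sum>b\<in>B. of_int (c b div int p) * b) + z)" .
    moreover have "algebraic_int ((\<Sum>b\<in>B. of_int (c b div int p) * b) + z)"
      using alg x(2) by (intro algebraic_int_add algebraic_int_sum algebraic_int_mult) auto
    moreover have "?y \<in> F" unfolding F_def using p0 by (intro imageI) auto
    ultimately show ?thesis by blast
  qed
  show thesis
  proof (rule that)
    show "finite F" unfolding F_def using fin by (intro finite_imageI finite_PiE) auto
    show "algebraic_int x" if "x \<in> F" for x
      using that alg by (auto simp: F_def intro!: algebraic_int_sum algebraic_int_mult)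
    fix x :: 'k assume x: "algebraic_int x"
    show "\<exists>y\<in>F. ?P (x - y)"
    proof (cases "x \<in> B")
      case True
      have "x = (\<Sum>b\<in>B. of_int (if b = x then 1 else 0) * b) + of_nat p * 0"
      proof -
        have "(\<Sum>b\<in>B. of_int (if b = x then 1 else 0) * b) = (\<Sum>b\<in>B. if b = x then b else 0)"
          by (intro sum.cong) auto
        then show ?thesis using True fin by simp
      qed
      then show ?thesis by (rule reduce) simp
    next
      case False
      \<comment> \<open>By maximality \<open>x\<close> satisfies a relation over \<open>B\<close>, and its coefficient at \<open>x\<close> is invertible modulo \<open>p\<close>.\<close>
      have "\<not> indep (insert x B)" using max[of "insert x B"] False fin by auto
      then obtain u z where u: "algebraic_int z" "(\<Sum>b\<in>insert x B. of_int (u b) * b) = of_nat p * z"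
        and nd: "\<exists>b\<in>insert x B. \<not> int p dvd u b"
        using x alg fin unfolding indep_def by auto
      have ux: "of_int (u x) * x + (\<Sum>b\<in>B. of_int (u b) * b) = of_nat p * z"
        using u(2) False fin by simp
      have "\<not> int p dvd u x"
      proof
        assume dvd: "int p dvd u x"
        then obtain k where k: "u x = int p * k" by blast
        have "(\<Sum>b\<in>B. of_int (u b) * b) = of_nat p * (z - of_int k * x)"
          using ux by (simp add: k algebra_simps)
        moreover have "algebraic_int (z - of_int k * x)"
          by (intro algebraic_int_diff algebraic_int_mult u(1) x algebraic_int_of_int)
        ultimately have "\<forall>b\<in>B. int p dvd u b" by (intro ind) blast
        then show False using nd dvd by blast
      qed
      then have "coprime (int p) (u x)" using p by (simp add: prime_imp_coprime)
      then obtain a c where "a * int p + c * u x = 1" using bezout_int[of "int p" "u x"] by auto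
      then have 1: "of_int a * of_nat p + of_int c * of_int (u x) = (1 :: 'k)"
        by (metis of_int_1 of_int_add of_int_mult of_int_of_nat_eq)
      have "x = (of_int a * of_nat p + of_int c * of_int (u x)) * x" by (simp add: 1)
      also have "\<dots> = of_int c * (of_int (u x) * x) + of_nat p * (of_int a * x)"
        by (simp add: algebra_simps)
      also have "of_int (u x) * x = of_nat p * z - (\<Sum>b\<in>B. of_int (u b) * b)"
        using ux by (simp add: eq_diff_eq)
      also have "of_int c * (of_nat p * z - (\<Sum>b\<in>B. of_int (u b) * b)) + of_nat p * (of_int a * x)
        = (\<Sum>b\<in>B. of_int (- c * u b) * b) + of_nat p * (of_int c * z + of_int a * x)"
        by (simp add: algebra_simps sum_distrib_left sum_negf)
      finally show ?thesis
        by (rule reduce) (intro algebraic_int_add algebraic_int_mult u(1) x algebraic_int_of_int)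
    qed
  qed
qed

text \<open>
  Residues modulo \<open>p * m\<close> have two digits: \<open>y + p * y'\<close> with \<open>y\<close> a residue modulo \<open>p\<close> and \<open>y'\<close> a
  residue modulo \<open>m\<close>.
\<close>

lemma finite_residues_nat:
  assumes nf: "number_field TYPE('k :: field_char_0)" and m: "(m :: nat) > 0"
  shows "\<exists>F :: 'k set. finite F \<and> (\<forall>x\<in>F. algebraic_int x) \<and>
    (\<forall>x. algebraic_int x \<longrightarrow> (\<exists>y\<in>F. \<exists>z. algebraic_int z \<and> x - y = of_nat m * z))"
  using m
proof (induction m rule: prime_divisors_induct)
  case zero
  then show ?case by simp
next
  case (unit m)
  then show ?case by (intro exI[of _ "{0}"]) auto
next
  case (factor p m)
  then have "m > 0" by (cases m) auto
  then obtain G :: "'k set" where G: "finite G" "\<And>x. x \<in> G \<Longrightarrow> algebraic_int x"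
    "\<And>x. algebraic_int x \<Longrightarrow> \<exists>y\<in>G. \<exists>z. algebraic_int z \<and> x - y = of_nat m * z"
    using factor.IH by blast
  obtain F :: "'k set" where F: "finite F" "\<And>x. x \<in> F \<Longrightarrow> algebraic_int x"
    "\<And>x. algebraic_int x \<Longrightarrow> \<exists>y\<in>F. \<exists>z. algebraic_int z \<and> x - y = of_nat p * z"
    using finite_residues_prime[OF nf, of p] factor.hyps by auto
  let ?H = "(\<lambda>(y, y'). y + of_nat p * y') ` (F \<times> G)"
  have "\<exists>y\<in>?H. \<exists>z. algebraic_int z \<and> x - y = of_nat (p * m) * z" if x: "algebraic_int x" for x
  proof -
    obtain y w where y: "y \<in> F" "algebraic_int w" "x - y = of_nat p * w" using F(3)[OF x] by blast
    obtain y' z where z: "y' \<in> G" "algebraic_int z" "w - y' = of_nat m * z" using G(3)[OF y(2)] by blast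
    have "x - (y + of_nat p * y') = of_nat p * (w - y')" using y(3) by (simp add: algebra_simps)
    also have "\<dots> = of_nat (p * m) * z" by (simp add: z(3))
    finally show ?thesis using y(1) z(1,2) by force
  qed
  then show ?case using F(1,2) G(1,2)
    by (intro exI[of _ ?H]) (auto intro!: algebraic_int_add algebraic_int_mult)
qed

text \<open>
  The integer is the lowest nonzero coefficient of an integral equation for \<open>g\<close>. It reduces residues
  modulo \<open>g\<close> to residues modulo a positive integer.
\<close>

lemma algebraic_int_dvd_int:
  fixes g :: "'k :: field_char_0"
  assumes g: "algebraic_int g" "g \<noteq> 0"
  obtains m :: nat and h where "m > 0" "algebraic_int h" "g * h = of_nat m"
proof -
  have *: "\<exists>k h. k \<noteq> (0::int) \<and> algebraic_int h \<and> g * h = of_int k"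
    if "poly (map_poly of_int p) g = 0" "p \<noteq> 0" for p :: "int poly"
    using that
  proof (induction p)
    case 0
    then show ?case by simp
  next
    case (pCons a p)
    have eq: "of_int a + g * poly (map_poly of_int p) g = 0"
      using pCons.prems(1) pCons.hyps by (simp add: map_poly_pCons)
    show ?case
    proof (cases "a = 0")
      case True
      then show ?thesis using eq pCons g(2) by auto
    next
      case False
      have "algebraic_int (poly (map_poly of_int p) g)"
        by (simp add: poly_altdef coeff_map_poly)
          (intro algebraic_int_sum algebraic_int_mult algebraic_int_power g algebraic_int_of_int)
      then show ?thesis using False eq
        by (intro exI[of _ "- a"] exI[of _ "poly (map_poly of_int p) g"])
          (simp add: eq_neg_iff_add_eq_0 add.commute)
    qed
  qed
  obtain p where p: "poly (map_poly of_int p) g = 0" "lead_coeff p = 1"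
    using g(1) unfolding algebraic_int_altdef_ipoly by blast
  then have "p \<noteq> 0" by auto
  with p obtain k h where k: "k \<noteq> (0::int)" "algebraic_int h" "g * h = of_int k"
    using *[of p] by blast
  show thesis
  proof (cases "k > 0")
    case True
    then show ?thesis using that[of "nat k" h] k by simp
  next
    case False
    then show ?thesis using that[of "nat (- k)" "- h"] k by simp
  qed
qed

lemma finite_residues:
  assumes nf: "number_field TYPE('k :: field_char_0)" and g: "algebraic_int (g :: 'k)" "g \<noteq> 0"
  obtains F :: "'k :: field_char_0 set" where "finite F" "\<And>x. x \<in> F \<Longrightarrow> algebraic_int x"
    "\<And>x. algebraic_int x \<Longrightarrow> \<exists>y\<in>F. \<exists>z. algebraic_int z \<and> x - y = g * z"
proof -
  obtain m h where m: "m > 0" "algebraic_int h" "g * h = of_nat m"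
    using algebraic_int_dvd_int[OF g] by blast
  obtain F :: "'k set" where F: "finite F" "\<And>x. x \<in> F \<Longrightarrow> algebraic_int x"
    "\<And>x. algebraic_int x \<Longrightarrow> \<exists>y\<in>F. \<exists>z. algebraic_int z \<and> x - y = of_nat m * z"
    using finite_residues_nat[OF nf m(1)] by blast
  show thesis
  proof (rule that[OF F(1,2)])
    fix x :: 'k assume "algebraic_int x"
    then obtain y z where "y \<in> F" "algebraic_int z" "x - y = of_nat m * z" using F(3) by blast
    then show "\<exists>y\<in>F. \<exists>z. algebraic_int z \<and> x - y = g * z"
      by (intro bexI[of _ y] exI[of _ "h * z"]) (simp_all add: m(3)[symmetric] algebraic_int_mult m(2))
  qed
qed

text \<open>
  The pigeonhole principle for residues modulo \<open>g\<close>, in the form in which it is applied to sequences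
  of powers.
\<close>

lemma congruent_terms:
  assumes nf: "number_field TYPE('k :: field_char_0)" and g: "algebraic_int (g :: 'k)" "g \<noteq> 0"
    and f: "\<And>n :: nat. algebraic_int (f n)"
  obtains i j z where "i < j" "algebraic_int z" "f j - f i = g * z"
proof -
  obtain F :: "'k set" where F: "finite F" "\<And>x. x \<in> F \<Longrightarrow> algebraic_int x"
    "\<And>x. algebraic_int x \<Longrightarrow> \<exists>y\<in>F. \<exists>z. algebraic_int z \<and> x - y = g * z"
    using finite_residues[OF nf g] by blast
  have "\<forall>n. \<exists>y z. y \<in> F \<and> algebraic_int z \<and> f n - y = g * z" using F(3)[OF f] by blast
  then obtain r q where r: "\<And>n. r n \<in> F" "\<And>n. algebraic_int (q n)" "\<And>n. f n - r n = g * q n"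
    by metis
  have "finite (range r)" using F(1) r(1) by (auto intro: finite_subset)
  then have "\<not> inj r" using finite_imageD[of r UNIV] by auto
  then obtain i j where "i < j" "r i = r j" by (metis injI linorder_neqE_nat)
  then show thesis
    using that[of i j "q j - q i"] r(3)[of i] r(3)[of j] algebraic_int_diff[OF r(2) r(2)]
    by (simp add: algebra_simps)
qed

section \<open>Ideals of the ring of integers\<close>

lemma ring_of_integers_simps [simp]:
  "x \<in> carrier \<O> \<longleftrightarrow> algebraic_int x"
  "x \<otimes>\<^bsub>\<O>\<^esub> y = x * y" "x \<oplus>\<^bsub>\<O>\<^esub> y = x + y" "\<one>\<^bsub>\<O>\<^esub> = 1" "\<zero>\<^bsub>\<O>\<^esub> = 0"
  by (simp_all add: ring_of_integers_def)

lemma cring_ring_of_integers: "cring (\<O> :: 'k :: field_char_0 ring)"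
proof (rule cringI)
  have inv: "\<exists>y\<in>carrier \<O>. y \<oplus>\<^bsub>\<O>\<^esub> x = \<zero>\<^bsub>\<O>\<^esub>" if "x \<in> carrier \<O>" for x :: 'k
    using that by (intro bexI[of _ "- x"]) simp_all
  show "abelian_group (\<O> :: 'k ring)"
  proof (rule abelian_groupI)
    show "\<exists>y\<in>carrier \<O>. y \<oplus>\<^bsub>\<O>\<^esub> x = \<zero>\<^bsub>\<O>\<^esub>" if "x \<in> carrier \<O>" for x :: 'k
      using that by (rule inv)
  qed (simp_all add: algebraic_int_add add_ac)
  show "Group.comm_monoid (\<O> :: 'k ring)"
    by (rule comm_monoidI) (simp_all add: algebraic_int_mult mult_ac)
qed (simp add: distrib_right)

interpretation ring_of_integers: cring "\<O> :: 'k :: field_char_0 ring"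
  by (rule cring_ring_of_integers)

lemma ideal_ring_of_integers_iff:
  fixes I :: "'k :: field_char_0 set"
  shows "ideal I \<O> \<longleftrightarrow> (\<forall>x\<in>I. algebraic_int x) \<and> 0 \<in> I \<and> (\<forall>x\<in>I. \<forall>y\<in>I. x + y \<in> I) \<and>
    (\<forall>x\<in>I. \<forall>r. algebraic_int r \<longrightarrow> r * x \<in> I)" (is "_ \<longleftrightarrow> ?R")
proof
  assume I: "ideal I \<O>"
  then interpret ideal I \<O> .
  show ?R using a_subset zero_closed a_closed I_l_closed by (auto simp flip: ring_of_integers_simps)
next
  assume R: ?R
  show "ideal I \<O>"
  proof (rule idealI)
    show "ring (\<O> :: 'k ring)" ..
    show "subgroup I (add_monoid \<O>)"
    proof (rule ring_of_integers.add.subgroupI)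
      fix x assume x: "x \<in> I"
      then have "- 1 * x \<in> I" using R by (metis algebraic_int_1 algebraic_int_minus)
      moreover have "\<ominus>\<^bsub>\<O>\<^esub> x = - x"
        using x R by (intro ring_of_integers.minus_equality) auto
      ultimately show "\<ominus>\<^bsub>\<O>\<^esub> x \<in> I" by simp
    qed (use R in auto)
  qed (use R in \<open>auto simp: mult.commute\<close>)
qed

lemma
  fixes I :: "'k :: field_char_0 set"
  assumes "ideal I \<O>"
  shows ideal_algebraic_int: "x \<in> I \<Longrightarrow> algebraic_int x"
    and ideal_zero: "0 \<in> I"
    and ideal_add: "x \<in> I \<Longrightarrow> y \<in> I \<Longrightarrow> x + y \<in> I"
    and ideal_mult: "algebraic_int r \<Longrightarrow> x \<in> I \<Longrightarrow> r * x \<in> I"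
    and ideal_mult_right: "algebraic_int r \<Longrightarrow> x \<in> I \<Longrightarrow> x * r \<in> I"
    and ideal_uminus: "x \<in> I \<Longrightarrow> - x \<in> I"
    and ideal_diff: "x \<in> I \<Longrightarrow> y \<in> I \<Longrightarrow> x - y \<in> I"
proof -
  have I: "\<forall>x\<in>I. algebraic_int x" "0 \<in> I" "\<forall>x\<in>I. \<forall>y\<in>I. x + y \<in> I"
    "\<forall>x\<in>I. \<forall>r. algebraic_int r \<longrightarrow> r * x \<in> I"
    using assms unfolding ideal_ring_of_integers_iff by blast+
  have minus: "- z \<in> I" if "z \<in> I" for z
    using bspec[OF I(4) that, THEN spec, of "- 1"] by simp
  show "x \<in> I \<Longrightarrow> algebraic_int x" "0 \<in> I" "x \<in> I \<Longrightarrow> y \<in> I \<Longrightarrow> x + y \<in> I"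
    "algebraic_int r \<Longrightarrow> x \<in> I \<Longrightarrow> r * x \<in> I" using I by blast+
  show "algebraic_int r \<Longrightarrow> x \<in> I \<Longrightarrow> x * r \<in> I" using I(4) by (metis mult.commute)
  show "x \<in> I \<Longrightarrow> - x \<in> I" by (rule minus)
  show "x \<in> I \<Longrightarrow> y \<in> I \<Longrightarrow> x - y \<in> I"
    using bspec[OF bspec[OF I(3), of x], of "- y"] minus[of y] by simp
qed

lemma mem_principal_ideal [simp]:
  "x \<in> PIdl\<^bsub>\<O>\<^esub> a \<longleftrightarrow> (\<exists>z. algebraic_int z \<and> x = a * z)"
  by (auto simp: cgenideal_def mult.commute)

lemma ideal_principal: "algebraic_int (a :: 'k :: field_char_0) \<Longrightarrow> ideal (PIdl\<^bsub>\<O>\<^esub> a) \<O>"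
  by (rule ring_of_integers.cgenideal_ideal) simp

lemma mem_ideal_sum [simp]:
  "x \<in> I <+>\<^bsub>\<O>\<^esub> J \<longleftrightarrow> (\<exists>i\<in>I. \<exists>j\<in>J. x = i + j)"
  by (auto simp: set_add_def')

lemma ideal_sum_upper:
  fixes I :: "'k :: field_char_0 set"
  assumes "ideal I \<O>" and "ideal J \<O>"
  shows "I \<subseteq> I <+>\<^bsub>\<O>\<^esub> J" and "J \<subseteq> I <+>\<^bsub>\<O>\<^esub> J"
  using ideal_zero[OF assms(1)] ideal_zero[OF assms(2)] by force+

lemma ideal_sum_least:
  fixes I :: "'k :: field_char_0 set"
  assumes "ideal K \<O>" "I \<subseteq> K" "J \<subseteq> K"
  shows "I <+>\<^bsub>\<O>\<^esub> J \<subseteq> K"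
  using assms(2,3) by (auto intro!: ideal_add[OF assms(1)])

lemma ideal_eq_carrier:
  fixes I :: "'k :: field_char_0 set"
  assumes "ideal I \<O>" and "1 \<in> I"
  shows "I = carrier \<O>"
  using ideal_mult[OF assms(1) _ assms(2)] ideal_algebraic_int[OF assms(1)] by auto

lemma nonzero_ideal_iff:
  fixes I :: "'k :: field_char_0 set"
  shows "nonzero_ideal \<O> I \<longleftrightarrow> ideal I \<O> \<and> (\<exists>x\<in>I. x \<noteq> 0)"
  using ideal_zero[of I] by (auto simp: nonzero_ideal_def)

text \<open>
  An ideal containing \<open>g\<close> is a union of residue classes modulo \<open>g\<close>, so it is determined by its
  intersection with a finite set of representatives.
\<close>

lemma finite_ideals_containing:
  fixes g :: "'k :: field_char_0"
  assumes nf: "number_field TYPE('k)" and g: "algebraic_int g" "g \<noteq> 0"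
  shows "finite {I. ideal I \<O> \<and> g \<in> I}"
proof -
  obtain F :: "'k set" where F: "finite F" "\<And>x. x \<in> F \<Longrightarrow> algebraic_int x"
    "\<And>x. algebraic_int x \<Longrightarrow> \<exists>y\<in>F. \<exists>z. algebraic_int z \<and> x - y = g * z"
    using finite_residues[OF nf g] by blast
  have sub: "I \<subseteq> J" if IJ: "ideal I \<O>" "g \<in> I" "ideal J \<O>" "g \<in> J" "I \<inter> F = J \<inter> F"
    for I J
  proof
    fix x assume x: "x \<in> I"
    then obtain y z where y: "y \<in> F" "algebraic_int z" "x - y = g * z"
      using F(3)[of x] ideal_algebraic_int[OF IJ(1)] by blast
    have "y = x - g * z" by (simp flip: y(3))
    then have "y \<in> I" using ideal_diff[OF IJ(1) x ideal_mult_right[OF IJ(1) y(2) IJ(2)]] by simp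
    then have "y \<in> J" using y(1) IJ(5) by blast
    then have "y + g * z \<in> J" using ideal_add[OF IJ(3) _ ideal_mult_right[OF IJ(3) y(2) IJ(4)]] by blast
    then show "x \<in> J" by (simp flip: y(3))
  qed
  have "inj_on (\<lambda>I. I \<inter> F) {I. ideal I \<O> \<and> g \<in> I}"
    by (rule inj_onI) (use sub in blast)
  then show ?thesis
    using F(1) by (rule_tac finite_imageD[OF finite_subset[of _ "Pow F"]]) auto
qed

text \<open>
  The ring of integers is integrally closed, in the form needed for inverting ideals. For a nonzero
  \<open>m\<close> in \<open>I\<close> all \<open>x ^ n * m\<close> lie in \<open>I\<close>, so two of them are congruent modulo \<open>m\<close>. Then \<open>x ^ j - x ^ i\<close>
  is an algebraic integer for some \<open>i < j\<close>, and \<open>x\<close> is a root of a monic polynomial over the algebraic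
  integers.
\<close>

lemma ideal_multiplier_integral:
  fixes x :: "'k :: field_char_0"
  assumes nf: "number_field TYPE('k)" and I: "nonzero_ideal \<O> I"
    and stable: "\<And>y. y \<in> I \<Longrightarrow> x * y \<in> I"
  shows "algebraic_int x"
proof -
  have id: "ideal I \<O>" using I by (simp add: nonzero_ideal_iff)
  obtain m where m: "m \<in> I" "m \<noteq> 0" using I by (auto simp: nonzero_ideal_iff)
  have pow: "x ^ n * m \<in> I" for n
    by (induction n) (use m stable in \<open>auto simp: mult.assoc\<close>)
  obtain i j z where ij: "i < j" "algebraic_int z" "x ^ j * m - x ^ i * m = m * z"
    using congruent_terms[OF nf ideal_algebraic_int[OF id m(1)] m(2), of "\<lambda>n. x ^ n * m"]
      ideal_algebraic_int[OF id pow] by blast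
  let ?p = "monom 1 j - monom 1 i :: 'k poly"
  have "m * (x ^ j - x ^ i) = m * z" using ij(3) by (simp add: algebra_simps)
  then have z: "poly ?p x = z" using m(2) by (simp add: poly_monom)
  have coeff: "coeff ?p k = (if k = j then 1 else 0) - (if k = i then 1 else 0)" for k by simp
  have deg: "degree ?p = j"
  proof (rule antisym)
    show "degree ?p \<le> j" by (rule degree_le) (use ij(1) in auto)
    show "j \<le> degree ?p" by (rule le_degree) (use ij(1) in auto)
  qed
  show ?thesis
  proof (rule algebraic_int_root[OF ij(2) z])
    show "\<forall>k. coeff ?p k \<in> \<int>" by (simp add: coeff)
    show "lead_coeff ?p = 1" unfolding deg using ij(1) by simp
    show "degree ?p > 0" unfolding deg using ij(1) by simp
  qed
qed

section \<open>Invertibility of ideals\<close>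

text \<open>
  In the finite ring of residues modulo \<open>a\<close> every element \<open>i\<close> satisfies \<open>i ^ p = i ^ (p + k)\<close> with
  \<open>k > 0\<close>, so \<open>1 - i ^ k\<close> kills a power of \<open>i\<close>. A product of such factors has the form \<open>1 - j\<close> with
  \<open>j\<close> in \<open>I\<close> and kills powers of all elements of \<open>S\<close> simultaneously.
\<close>

lemma ideal_one_minus_nilpotent:
  fixes a :: "'k :: field_char_0"
  assumes nf: "number_field TYPE('k)" and a: "algebraic_int a" "a \<noteq> 0"
    and I: "ideal I \<O>" and S: "finite S" "S \<subseteq> I"
  shows "\<exists>j\<in>I. \<forall>i\<in>S. \<exists>n. (1 - j) * i ^ n \<in> PIdl\<^bsub>\<O>\<^esub> a"
  using S
proof (induction S)
  case empty
  then show ?case using ideal_zero[OF I] by auto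
next
  case (insert i S)
  then obtain j where j: "j \<in> I" "\<forall>i\<in>S. \<exists>n. (1 - j) * i ^ n \<in> PIdl\<^bsub>\<O>\<^esub> a" by blast
  have A: "ideal (PIdl\<^bsub>\<O>\<^esub> a) \<O>" by (rule ideal_principal[OF a(1)])
  have i: "i \<in> I" "algebraic_int i" using insert.prems ideal_algebraic_int[OF I] by auto
  obtain p q z where pq: "p < q" "algebraic_int z" "i ^ q - i ^ p = a * z"
    using congruent_terms[OF nf a, of "\<lambda>n. i ^ n"] algebraic_int_power[OF i(2)] by blast
  define k where "k = q - p"
  have k: "k > 0" "q = p + k" using pq(1) by (auto simp: k_def)
  have ik: "i ^ k \<in> I"
    using k(1) ideal_mult_right[OF I algebraic_int_power[OF i(2), of "k - 1"] i(1)]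
    by (metis power_minus_mult mult.commute)
  have int: "algebraic_int (1 - j)" "algebraic_int (1 - i ^ k)"
    using ideal_algebraic_int[OF I] j(1) ik by (auto intro: algebraic_int_diff)
  let ?j = "j + (1 - j) * i ^ k"
  have eq: "1 - ?j = (1 - i ^ k) * (1 - j)" by (simp add: algebra_simps)
  have "?j \<in> I" using ideal_add[OF I j(1) ideal_mult[OF I int(1) ik]] .
  moreover have "\<exists>n. (1 - ?j) * i' ^ n \<in> PIdl\<^bsub>\<O>\<^esub> a" if "i' \<in> insert i S" for i'
  proof (cases "i' = i")
    case True
    have "(1 - ?j) * i ^ p = (1 - j) * (- (i ^ q - i ^ p))"
      unfolding eq k(2) by (simp add: algebra_simps power_add)
    also have "\<dots> = a * (- z * (1 - j))" unfolding pq(3) by simp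
    finally show ?thesis
      using True int(1) pq(2) by (auto intro!: exI[of _ p] exI[of _ "- z * (1 - j)"] algebraic_int_mult
          simp del: mult_minus_left)
  next
    case False
    then obtain n where "(1 - j) * i' ^ n \<in> PIdl\<^bsub>\<O>\<^esub> a" using \<open>i' \<in> insert i S\<close> j(2) by blast
    from ideal_mult[OF A int(2) this] show ?thesis unfolding eq mult.assoc by blast
  qed
  ultimately show ?case by blast
qed

text \<open>
  Multiply \<open>r\<close> by each element of \<open>S\<close> in turn as often as possible without entering \<open>A\<close>.
\<close>

lemma annihilator_of_nilpotents:
  fixes r :: "'k :: field_char_0"
  assumes A: "ideal A \<O>" and r: "r \<notin> A"
    and S: "finite S" "\<And>i. i \<in> S \<Longrightarrow> algebraic_int i" "\<And>i. i \<in> S \<Longrightarrow> \<exists>n. r * i ^ n \<in> A"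
  shows "\<exists>t. algebraic_int t \<and> r * t \<notin> A \<and> (\<forall>i\<in>S. r * t * i \<in> A)"
  using S
proof (induction S)
  case empty
  then show ?case using r by (intro exI[of _ 1]) simp
next
  case (insert i S)
  then obtain t where t: "algebraic_int t" "r * t \<notin> A" "\<forall>i\<in>S. r * t * i \<in> A" by auto
  have i: "algebraic_int i" using insert.prems by simp
  obtain n where "r * i ^ n \<in> A" using insert.prems by blast
  then have "r * t * i ^ n \<in> A" using ideal_mult[OF A t(1), of "r * i ^ n"] by (simp add: mult_ac)
  then obtain m where m: "r * t * i ^ m \<notin> A" "r * t * i ^ Suc m \<in> A"
  proof -
    define m where "m = (LEAST n. r * t * i ^ n \<in> A)"
    have mA: "r * t * i ^ m \<in> A" unfolding m_def using \<open>r * t * i ^ n \<in> A\<close> by (rule LeastI)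
    then have "m \<noteq> 0" using t(2) by (intro notI) simp
    then obtain k where k: "m = Suc k" by (cases m) auto
    have "r * t * i ^ k \<notin> A" using not_less_Least[of k "\<lambda>n. r * t * i ^ n \<in> A"] k by (simp add: m_def)
    then show thesis using that mA k by blast
  qed
  have pow: "algebraic_int (i ^ m)" by (rule algebraic_int_power[OF i])
  have "r * (t * i ^ m) * i' \<in> A" if "i' \<in> insert i S" for i'
  proof (cases "i' = i")
    case True
    then show ?thesis using m(2) by (simp add: mult_ac)
  next
    case False
    then have "r * t * i' \<in> A" using that t(3) by blast
    from ideal_mult[OF A pow this] show ?thesis by (simp add: mult_ac)
  qed
  then show ?case using m(1) algebraic_int_mult[OF t(1) pow]
    by (intro exI[of _ "t * i ^ m"]) (auto simp: mult.assoc)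
qed

text \<open>
  Modulo \<open>a\<close> a proper ideal has a nonzero annihilator; in other words \<open>r / a\<close> is a non-integral
  element that multiplies \<open>I\<close> into the ring of integers. Since \<open>I\<close> is proper, the element \<open>1 - j\<close> of
  \<open>ideal_one_minus_nilpotent\<close> is nonzero modulo \<open>a\<close>, and modulo \<open>a\<close> finitely many elements exhaust \<open>I\<close>, so
  \<open>annihilator_of_nilpotents\<close> applies.
\<close>

lemma proper_ideal_annihilated:
  fixes a :: "'k :: field_char_0"
  assumes nf: "number_field TYPE('k)" and I: "ideal I \<O>" "I \<noteq> carrier \<O>" and a: "a \<in> I" "a \<noteq> 0"
  shows "\<exists>r. algebraic_int r \<and> r \<notin> PIdl\<^bsub>\<O>\<^esub> a \<and> (\<forall>i\<in>I. r * i \<in> PIdl\<^bsub>\<O>\<^esub> a)"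
proof -
  let ?A = "PIdl\<^bsub>\<O>\<^esub> a"
  have ai: "algebraic_int a" by (rule ideal_algebraic_int[OF I(1) a(1)])
  have A: "ideal ?A \<O>" by (rule ideal_principal[OF ai])
  have AI: "x \<in> I" if "x \<in> ?A" for x
    using that ideal_mult_right[OF I(1) _ a(1)] by auto
  obtain F :: "'k set" where F: "finite F" "\<And>x. x \<in> F \<Longrightarrow> algebraic_int x"
    "\<And>x. algebraic_int x \<Longrightarrow> \<exists>y\<in>F. \<exists>z. algebraic_int z \<and> x - y = a * z"
    using finite_residues[OF nf ai a(2)] by blast
  obtain j where j: "j \<in> I" "\<forall>i\<in>F \<inter> I. \<exists>n. (1 - j) * i ^ n \<in> ?A"
    using ideal_one_minus_nilpotent[OF nf ai a(2) I(1), of "F \<inter> I"] F(1) by blast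
  have "1 - j \<notin> ?A"
  proof
    assume "1 - j \<in> ?A"
    then have "1 \<in> I" using ideal_add[OF I(1) AI j(1), of "1 - j"] by simp
    then show False using ideal_eq_carrier[OF I(1)] I(2) by blast
  qed
  then obtain t where t: "algebraic_int t" "(1 - j) * t \<notin> ?A" "\<forall>i\<in>F \<inter> I. (1 - j) * t * i \<in> ?A"
    using annihilator_of_nilpotents[OF A, of "1 - j" "F \<inter> I"] F(1,2) j(2) by blast
  define r where "r = (1 - j) * t"
  have r: "algebraic_int r" unfolding r_def
    using algebraic_int_mult[OF algebraic_int_diff[OF algebraic_int_1 ideal_algebraic_int[OF I(1) j(1)]] t(1)] .
  have "r * i \<in> ?A" if i: "i \<in> I" for i
  proof -
    obtain y z where y: "y \<in> F" "algebraic_int z" "i - y = a * z"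
      using F(3)[OF ideal_algebraic_int[OF I(1) i]] by blast
    have az: "a * z \<in> ?A" using y(2) by auto
    have "y = i - a * z" by (simp flip: y(3))
    then have "y \<in> I" using ideal_diff[OF I(1) i AI[OF az]] by simp
    then have "r * y \<in> ?A" using y(1) t(3) by (simp only: r_def) blast
    then have "r * y + r * (a * z) \<in> ?A" by (rule ideal_add[OF A _ ideal_mult[OF A r az]])
    moreover have "r * y + r * (a * z) = r * i" unfolding y(3)[symmetric] by (simp add: algebra_simps)
    ultimately show ?thesis by (simp only:)
  qed
  then show ?thesis using r t(2) unfolding r_def by blast
qed

lemma principal_ideal_prod:
  fixes c :: "'k :: field_char_0"
  assumes c: "algebraic_int c" and K: "ideal K \<O>"
  shows "(PIdl\<^bsub>\<O>\<^esub> c) \<cdot>\<^bsub>\<O>\<^esub> K = (*) c ` K"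
proof
  show "(PIdl\<^bsub>\<O>\<^esub> c) \<cdot>\<^bsub>\<O>\<^esub> K \<subseteq> (*) c ` K"
  proof
    fix x assume "x \<in> (PIdl\<^bsub>\<O>\<^esub> c) \<cdot>\<^bsub>\<O>\<^esub> K"
    then show "x \<in> (*) c ` K"
    proof (induction rule: ideal_prod.induct)
      case (prod i j)
      then obtain z where "algebraic_int z" "i = c * z" by auto
      then show ?case using ideal_mult[OF K _ prod(2), of z] by (auto simp: mult.assoc)
    next
      case (sum x y)
      then obtain u v where "u \<in> K" "v \<in> K" "x = c * u" "y = c * v" by blast
      then show ?case using ideal_add[OF K, of u v] by (auto simp flip: distrib_left)
    qed
  qed
  show "(*) c ` K \<subseteq> (PIdl\<^bsub>\<O>\<^esub> c) \<cdot>\<^bsub>\<O>\<^esub> K"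
  proof
    fix x assume "x \<in> (*) c ` K"
    then obtain k where "k \<in> K" "x = c * k" by blast
    moreover have "c \<in> PIdl\<^bsub>\<O>\<^esub> c" by (auto intro: exI[of _ 1])
    ultimately show "x \<in> (PIdl\<^bsub>\<O>\<^esub> c) \<cdot>\<^bsub>\<O>\<^esub> K"
      using ideal_prod.prod[of c "PIdl\<^bsub>\<O>\<^esub> c" k K \<O>] by simp
  qed
qed

lemma ideal_divided_by_principal:
  fixes c :: "'k :: field_char_0"
  assumes c: "algebraic_int c" and K: "ideal K \<O>" "K \<subseteq> PIdl\<^bsub>\<O>\<^esub> c"
  shows "\<exists>C. ideal C \<O> \<and> (PIdl\<^bsub>\<O>\<^esub> c) \<cdot>\<^bsub>\<O>\<^esub> C = K"
proof -
  define C where "C = {x. algebraic_int x \<and> c * x \<in> K}"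
  have C: "ideal C \<O>" unfolding ideal_ring_of_integers_iff C_def
    using ideal_zero[OF K(1)] ideal_add[OF K(1)] ideal_mult[OF K(1)]
    by (auto simp: distrib_left mult.left_commute intro: algebraic_int_add algebraic_int_mult)
  have "x \<in> (*) c ` C" if "x \<in> K" for x
    using that subsetD[OF K(2) that] by (auto simp: C_def)
  then have "(*) c ` C = K" by (auto simp: C_def)
  then show ?thesis using C principal_ideal_prod[OF c C] by blast
qed

lemma ideal_prod_subset:
  fixes I :: "'k :: field_char_0 set"
  assumes "ideal K \<O>" and "\<And>i j. i \<in> I \<Longrightarrow> j \<in> J \<Longrightarrow> i * j \<in> K"
  shows "I \<cdot>\<^bsub>\<O>\<^esub> J \<subseteq> K"
proof
  fix x assume "x \<in> I \<cdot>\<^bsub>\<O>\<^esub> J"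
  then show "x \<in> K" by (induction rule: ideal_prod.induct) (use assms(2) ideal_add[OF assms(1)] in auto)
qed

text \<open>
  Induction on the finite number of ideals above \<open>I\<close>.
  For a proper \<open>I\<close> containing \<open>a \<noteq> 0\<close> let \<open>E\<close> be the ideal of all \<open>e\<close> with \<open>e I \<subseteq> (a)\<close>, and write
  \<open>E I = (a) J\<close>. Then \<open>I \<subseteq> J\<close> because \<open>a\<close> is in \<open>E\<close>. If \<open>J\<close> were equal to \<open>I\<close>, the non-integral
  multiplier \<open>r / a\<close> would preserve \<open>I\<close>, which integral closedness forbids. So \<open>J\<close> is strictly larger,
  and if \<open>J F = (c)\<close> then \<open>I (E F) = (a c)\<close>.
\<close>

lemma ideal_inverse:
  fixes I :: "'k :: field_char_0 set"
  assumes nf: "number_field TYPE('k)" and I: "nonzero_ideal \<O> I"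
  obtains J c where "ideal J \<O>" "algebraic_int c" "c \<noteq> 0" "I \<cdot>\<^bsub>\<O>\<^esub> J = PIdl\<^bsub>\<O>\<^esub> c"
proof -
  have "\<exists>J c. ideal J \<O> \<and> algebraic_int c \<and> c \<noteq> 0 \<and> I \<cdot>\<^bsub>\<O>\<^esub> J = PIdl\<^bsub>\<O>\<^esub> c"
    using I
  proof (induction "card {K. ideal K \<O> \<and> I \<subseteq> K}" arbitrary: I rule: less_induct)
    case (less I)
    have I: "ideal I \<O>" using less.prems by (simp add: nonzero_ideal_iff)
    show ?case
    proof (cases "I = carrier \<O>")
      case True
      have "(PIdl\<^bsub>\<O>\<^esub> 1 :: 'k set) = carrier \<O>" by auto
      then show ?thesis
        using True I ring_of_integers.ideal_prod_one[OF I] by (intro exI[of _ I] exI[of _ 1]) simp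
    next
      case False
      obtain a where a: "a \<in> I" "a \<noteq> 0" using less.prems by (auto simp: nonzero_ideal_iff)
      have ai: "algebraic_int a" by (rule ideal_algebraic_int[OF I a(1)])
      let ?A = "PIdl\<^bsub>\<O>\<^esub> a"
      have A: "ideal ?A \<O>" by (rule ideal_principal[OF ai])
      obtain r where r: "algebraic_int r" "r \<notin> ?A" "\<forall>i\<in>I. r * i \<in> ?A"
        using proper_ideal_annihilated[OF nf I False a] by blast
      define E where "E = {e. algebraic_int e \<and> (\<forall>i\<in>I. e * i \<in> ?A)}"
      have E: "ideal E \<O>" unfolding ideal_ring_of_integers_iff E_def
        using ideal_zero[OF A] ideal_add[OF A] ideal_mult[OF A]
        by (auto simp del: mem_principal_ideal simp: distrib_right mult.assoc
            intro: algebraic_int_add algebraic_int_mult)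
      have EI: "ideal (E \<cdot>\<^bsub>\<O>\<^esub> I) \<O>" by (rule ring_of_integers.ideal_prod_is_ideal[OF E I])
      have "E \<cdot>\<^bsub>\<O>\<^esub> I \<subseteq> ?A" by (rule ideal_prod_subset[OF A]) (auto simp: E_def)
      then obtain J where J: "ideal J \<O>" "?A \<cdot>\<^bsub>\<O>\<^esub> J = E \<cdot>\<^bsub>\<O>\<^esub> I"
        using ideal_divided_by_principal[OF ai EI] by blast
      have img: "(*) a ` J = E \<cdot>\<^bsub>\<O>\<^esub> I" using J(2) unfolding principal_ideal_prod[OF ai J(1)] .
      have J_iff: "x \<in> J \<longleftrightarrow> a * x \<in> E \<cdot>\<^bsub>\<O>\<^esub> I" for x
        unfolding img[symmetric] using a(2) by auto
      have "a \<in> E" using ai ideal_algebraic_int[OF I] by (auto simp: E_def)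
      then have IJ: "I \<subseteq> J" using ideal_prod.prod[of a E _ I \<O>] by (auto simp: J_iff)
      have "J \<noteq> I"
      proof
        assume JI: "J = I"
        have "r / a * y \<in> I" if "y \<in> I" for y
        proof -
          have "r \<in> E" using r by (auto simp: E_def simp del: mem_principal_ideal)
          then have "r * y \<in> E \<cdot>\<^bsub>\<O>\<^esub> I" using ideal_prod.prod[of r E y I \<O>] that by simp
          moreover have "r * y = a * (r / a * y)" using a(2) by simp
          ultimately have "a * (r / a * y) \<in> E \<cdot>\<^bsub>\<O>\<^esub> I" by (simp only:)
          then show ?thesis unfolding J_iff[symmetric] JI .
        qed
        then have "algebraic_int (r / a)" by (rule ideal_multiplier_integral[OF nf less.prems])
        then have "r \<in> ?A" using a(2) by (auto intro!: exI[of _ "r / a"])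
        then show False using r(2) by blast
      qed
      then have "{K. ideal K \<O> \<and> J \<subseteq> K} \<subset> {K. ideal K \<O> \<and> I \<subseteq> K}" using I IJ by blast
      moreover have "finite {K. ideal K \<O> \<and> I \<subseteq> K}"
        by (rule finite_subset[OF _ finite_ideals_containing[OF nf ai a(2)]]) (use a(1) in blast)
      ultimately have "card {K. ideal K \<O> \<and> J \<subseteq> K} < card {K. ideal K \<O> \<and> I \<subseteq> K}"
        by (intro psubset_card_mono)
      moreover have "nonzero_ideal \<O> J" using J(1) IJ a by (auto simp: nonzero_ideal_iff)
      ultimately obtain F c where F: "ideal F \<O>" "algebraic_int c" "c \<noteq> 0" "J \<cdot>\<^bsub>\<O>\<^esub> F = PIdl\<^bsub>\<O>\<^esub> c"
        using less.hyps[of J] by blast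
      have "I \<cdot>\<^bsub>\<O>\<^esub> (E \<cdot>\<^bsub>\<O>\<^esub> F) = (E \<cdot>\<^bsub>\<O>\<^esub> I) \<cdot>\<^bsub>\<O>\<^esub> F"
        using ring_of_integers.ideal_prod_assoc[OF I E F(1)] ring_of_integers.ideal_prod_commute[OF I E]
        by simp
      also have "\<dots> = ?A \<cdot>\<^bsub>\<O>\<^esub> (J \<cdot>\<^bsub>\<O>\<^esub> F)"
        using ring_of_integers.ideal_prod_assoc[OF A J(1) F(1)] J(2) by simp
      also have "\<dots> = (*) a ` (PIdl\<^bsub>\<O>\<^esub> c)"
        unfolding F(4) by (rule principal_ideal_prod[OF ai ideal_principal[OF F(2)]])
      also have "\<dots> = PIdl\<^bsub>\<O>\<^esub> (a * c)"
      proof (rule Set.set_eqI)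
        fix x
        have "x \<in> (*) a ` (PIdl\<^bsub>\<O>\<^esub> c) \<longleftrightarrow> (\<exists>z. algebraic_int z \<and> x = a * (c * z))"
          unfolding image_iff Bex_def mem_principal_ideal by blast
        then show "x \<in> (*) a ` (PIdl\<^bsub>\<O>\<^esub> c) \<longleftrightarrow> x \<in> PIdl\<^bsub>\<O>\<^esub> (a * c)"
          by (simp add: mult.assoc)
      qed
      finally show ?thesis
        using ring_of_integers.ideal_prod_is_ideal[OF E F(1)] algebraic_int_mult[OF ai F(2)] a(2) F(3)
        by (intro exI[of _ "E \<cdot>\<^bsub>\<O>\<^esub> F"] exI[of _ "a * c"]) simp
    qed
  qed
  then show thesis using that by blast
qed

text \<open>
  Multiplication by \<open>J\<close> with \<open>D J = (c)\<close> turns both sides into dilations by the nonzero number \<open>c\<close>.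
\<close>

lemma ideal_prod_cancel:
  fixes D :: "'k :: field_char_0 set"
  assumes nf: "number_field TYPE('k)" and D: "nonzero_ideal \<O> D"
    and X: "ideal X \<O>" and Y: "ideal Y \<O>" and eq: "D \<cdot>\<^bsub>\<O>\<^esub> X = D \<cdot>\<^bsub>\<O>\<^esub> Y"
  shows "X = Y"
proof -
  obtain J c where J: "ideal J \<O>" "algebraic_int c" "c \<noteq> 0" "D \<cdot>\<^bsub>\<O>\<^esub> J = PIdl\<^bsub>\<O>\<^esub> c"
    using ideal_inverse[OF nf D] by blast
  have D': "ideal D \<O>" using D by (simp add: nonzero_ideal_iff)
  have *: "(*) c ` Z = J \<cdot>\<^bsub>\<O>\<^esub> (D \<cdot>\<^bsub>\<O>\<^esub> Z)" if Z: "ideal Z \<O>" for Z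
    using principal_ideal_prod[OF J(2) Z] ring_of_integers.ideal_prod_assoc[OF J(1) D' Z]
      ring_of_integers.ideal_prod_commute[OF J(1) D'] J(4) by simp
  have "(*) c ` X = (*) c ` Y" unfolding *[OF X] *[OF Y] eq ..
  moreover have "inj ((*) c)" using J(3) by (simp add: inj_on_def)
  ultimately show ?thesis by (simp only: inj_image_eq_iff)
qed

text \<open>
  If \<open>D J = (c)\<close>, then \<open>B J \<subseteq> (c)\<close> and thus \<open>B J = (c) C\<close>. Multiplying by \<open>D\<close> and cancelling
  \<open>(c)\<close> gives \<open>B = D C\<close>.
\<close>

lemma ideal_contains_imp_divides:
  fixes D :: "'k :: field_char_0 set"
  assumes nf: "number_field TYPE('k)" and D: "nonzero_ideal \<O> D" and B: "ideal B \<O>" "B \<subseteq> D"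
  shows "\<exists>C. ideal C \<O> \<and> D \<cdot>\<^bsub>\<O>\<^esub> C = B"
proof -
  obtain J c where J: "ideal J \<O>" "algebraic_int c" "c \<noteq> 0" "D \<cdot>\<^bsub>\<O>\<^esub> J = PIdl\<^bsub>\<O>\<^esub> c"
    using ideal_inverse[OF nf D] by blast
  have D': "ideal D \<O>" using D by (simp add: nonzero_ideal_iff)
  have P: "ideal (PIdl\<^bsub>\<O>\<^esub> c) \<O>" by (rule ideal_principal[OF J(2)])
  have BJ: "ideal (B \<cdot>\<^bsub>\<O>\<^esub> J) \<O>" by (rule ring_of_integers.ideal_prod_is_ideal[OF B(1) J(1)])
  have "B \<cdot>\<^bsub>\<O>\<^esub> J \<subseteq> PIdl\<^bsub>\<O>\<^esub> c"
  proof (rule ideal_prod_subset[OF P])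
    fix i j assume "i \<in> B" "j \<in> J"
    then show "i * j \<in> PIdl\<^bsub>\<O>\<^esub> c"
      using ideal_prod.prod[of i D j J \<O>] B(2) J(4) by auto
  qed
  then obtain C where C: "ideal C \<O>" "(PIdl\<^bsub>\<O>\<^esub> c) \<cdot>\<^bsub>\<O>\<^esub> C = B \<cdot>\<^bsub>\<O>\<^esub> J"
    using ideal_divided_by_principal[OF J(2) BJ] by blast
  have DC: "ideal (D \<cdot>\<^bsub>\<O>\<^esub> C) \<O>" by (rule ring_of_integers.ideal_prod_is_ideal[OF D' C(1)])
  have "(PIdl\<^bsub>\<O>\<^esub> c) \<cdot>\<^bsub>\<O>\<^esub> (D \<cdot>\<^bsub>\<O>\<^esub> C) = D \<cdot>\<^bsub>\<O>\<^esub> ((PIdl\<^bsub>\<O>\<^esub> c) \<cdot>\<^bsub>\<O>\<^esub> C)"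
    using ring_of_integers.ideal_prod_assoc[OF P D' C(1)] ring_of_integers.ideal_prod_assoc[OF D' P C(1)]
      ring_of_integers.ideal_prod_commute[OF P D'] by simp
  also have "\<dots> = (D \<cdot>\<^bsub>\<O>\<^esub> J) \<cdot>\<^bsub>\<O>\<^esub> B"
    unfolding C(2) using ring_of_integers.ideal_prod_assoc[OF D' J(1) B(1)]
      ring_of_integers.ideal_prod_commute[OF J(1) B(1)] by simp
  finally have eq: "(PIdl\<^bsub>\<O>\<^esub> c) \<cdot>\<^bsub>\<O>\<^esub> (D \<cdot>\<^bsub>\<O>\<^esub> C) = (PIdl\<^bsub>\<O>\<^esub> c) \<cdot>\<^bsub>\<O>\<^esub> B" unfolding J(4) .
  have "nonzero_ideal \<O> (PIdl\<^bsub>\<O>\<^esub> c)" using P J(3) by (auto simp: nonzero_ideal_iff intro!: exI[of _ 1])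
  from ideal_prod_cancel[OF nf this DC B(1) eq] show ?thesis using C(1) by blast
qed

section \<open>Periods and infinite coprime families\<close>

text \<open>
  The map \<open>\<cc> \<mapsto> \<cc> + \<ss>\<close> takes values in the finite set of ideals containing a fixed nonzero element
  of \<open>\<ss>\<close>, so it identifies two distinct members of \<open>\<C>\<close>. Their common image contains both of them, and
  hence their sum, which is the whole ring.
\<close>

lemma exists_coprime_to_ideal:
  fixes \<C> :: "'k :: field_char_0 set set"
  assumes nf: "number_field TYPE('k)" and \<ss>: "nonzero_ideal \<O> \<ss>"
    and \<C>: "infinite \<C>" "\<And>\<cc>. \<cc> \<in> \<C> \<Longrightarrow> ideal \<cc> \<O>" "pairwise_coprime \<O> \<C>"
  shows "\<exists>\<cc>\<in>\<C>. \<cc> <+>\<^bsub>\<O>\<^esub> \<ss> = carrier \<O>"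
proof (rule ccontr)
  assume none: "\<not> ?thesis"
  have s: "ideal \<ss> \<O>" using \<ss> by (simp add: nonzero_ideal_iff)
  obtain m where m: "m \<in> \<ss>" "m \<noteq> 0" using \<ss> by (auto simp: nonzero_ideal_iff)
  have sum: "ideal (\<cc> <+>\<^bsub>\<O>\<^esub> \<ss>) \<O>" if "\<cc> \<in> \<C>" for \<cc>
    by (rule ring_of_integers.add_ideals[OF \<C>(2)[OF that] s])
  have "inj_on (\<lambda>\<cc>. \<cc> <+>\<^bsub>\<O>\<^esub> \<ss>) \<C>"
  proof (rule inj_onI, rule ccontr)
    fix \<cc> \<cc>' assume c: "\<cc> \<in> \<C>" "\<cc>' \<in> \<C>" "\<cc> <+>\<^bsub>\<O>\<^esub> \<ss> = \<cc>' <+>\<^bsub>\<O>\<^esub> \<ss>" "\<cc> \<noteq> \<cc>'"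
    have "carrier \<O> = \<cc> <+>\<^bsub>\<O>\<^esub> \<cc>'" using \<C>(3) c by (simp add: pairwise_coprime_def pairwise_def)
    also have "\<dots> \<subseteq> \<cc> <+>\<^bsub>\<O>\<^esub> \<ss>"
    proof (rule ideal_sum_least[OF sum[OF c(1)]])
      show "\<cc> \<subseteq> \<cc> <+>\<^bsub>\<O>\<^esub> \<ss>" by (rule ideal_sum_upper(1)[OF \<C>(2)[OF c(1)] s])
      show "\<cc>' \<subseteq> \<cc> <+>\<^bsub>\<O>\<^esub> \<ss>" unfolding c(3) by (rule ideal_sum_upper(1)[OF \<C>(2)[OF c(2)] s])
    qed
    finally have "carrier \<O> \<subseteq> \<cc> <+>\<^bsub>\<O>\<^esub> \<ss>" .
    moreover have "\<cc> <+>\<^bsub>\<O>\<^esub> \<ss> \<subseteq> carrier \<O>"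
      using ideal_algebraic_int[OF sum[OF c(1)]] by (auto simp del: mem_ideal_sum)
    ultimately show False using none c(1) by blast
  qed
  moreover have "(\<lambda>\<cc>. \<cc> <+>\<^bsub>\<O>\<^esub> \<ss>) ` \<C> \<subseteq> {I. ideal I \<O> \<and> m \<in> I}"
    using sum ideal_sum_upper(2)[OF \<C>(2) s] m(1) by blast
  then have "finite ((\<lambda>\<cc>. \<cc> <+>\<^bsub>\<O>\<^esub> \<ss>) ` \<C>)"
    using finite_ideals_containing[OF nf ideal_algebraic_int[OF s m(1)] m(2)] by (rule finite_subset)
  ultimately show False using \<C>(1) finite_imageD by blast
qed

lemma mem_Per_eta_iff:
  assumes "g \<in> carrier \<O>" and "ideal \<ss> (\<O> :: 'k :: field_char_0 ring)"
  shows "g \<in> Per \<O> (eta \<O> \<BB>) \<ss> \<longleftrightarrow> (\<forall>s\<in>\<ss>. g + s \<in> multiples \<BB> \<longleftrightarrow> g \<in> multiples \<BB>)"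
  using assms algebraic_int_add[OF _ ideal_algebraic_int[OF assms(2)], of g]
  by (auto simp: Per_def eta_def free_elements_def indicator_def)

text \<open>
  If \<open>g\<close> lies in \<open>\<dd>\<close> and \<open>\<dd> \<cc>\<close> belongs to \<open>\<BB>\<close> with \<open>\<cc>\<close> coprime to \<open>\<ss>\<close>, write \<open>1 = u + v\<close> with \<open>u\<close> in
  \<open>\<cc>\<close> and \<open>v\<close> in \<open>\<ss>\<close>. The translation of \<open>g\<close> by \<open>- g v\<close> gives \<open>g u\<close>, an element of \<open>\<dd> \<cc>\<close>.
\<close>

lemma not_period_of_D_multiple:
  fixes \<BB> :: "'k :: field_char_0 set set"
  assumes nf: "number_field TYPE('k)" and \<ss>: "nonzero_ideal \<O> \<ss>"
    and g: "g \<in> multiples (D_ideals \<O> \<BB>)" "g \<in> free_elements \<O> \<BB>"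
  shows "g \<notin> Per \<O> (eta \<O> \<BB>) \<ss>"
proof -
  obtain \<dd> where \<dd>: "g \<in> \<dd>" "\<dd> \<in> D_ideals \<O> \<BB>" using g(1) by (auto simp: multiples_def)
  then obtain \<C> where \<C>: "infinite \<C>" "\<And>\<cc>. \<cc> \<in> \<C> \<Longrightarrow> ideal \<cc> \<O>" "pairwise_coprime \<O> \<C>"
    "\<And>\<cc>. \<cc> \<in> \<C> \<Longrightarrow> \<dd> \<cdot>\<^bsub>\<O>\<^esub> \<cc> \<in> \<BB>"
    unfolding D_ideals_def mem_Collect_eq by blast
  obtain \<cc> where \<cc>: "\<cc> \<in> \<C>" "\<cc> <+>\<^bsub>\<O>\<^esub> \<ss> = carrier \<O>"
    using exists_coprime_to_ideal[OF nf \<ss> \<C>(1-3)] by blast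
  have s: "ideal \<ss> \<O>" using \<ss> by (simp add: nonzero_ideal_iff)
  have "1 \<in> \<cc> <+>\<^bsub>\<O>\<^esub> \<ss>" unfolding \<cc>(2) by simp
  then obtain u v where uv: "u \<in> \<cc>" "v \<in> \<ss>" "1 = u + v" by auto
  have gint: "g \<in> carrier \<O>" using g(2) by (simp add: free_elements_def)
  have "g + - (g * v) = g * (u + v) - g * v" unfolding uv(3)[symmetric] by simp
  also have "\<dots> = g * u" by (simp add: algebra_simps)
  also have "\<dots> \<in> \<dd> \<cdot>\<^bsub>\<O>\<^esub> \<cc>" using ideal_prod.prod[of g \<dd> u \<cc> \<O>] \<dd>(1) uv(1) by simp
  finally have "g + - (g * v) \<in> multiples \<BB>" using \<C>(4)[OF \<cc>(1)] by (auto simp: multiples_def)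
  moreover have "- (g * v) \<in> \<ss>" using gint by (intro ideal_uminus[OF s] ideal_mult[OF s] uv(2)) simp
  moreover have "g \<notin> multiples \<BB>" using g(2) by (simp add: free_elements_def)
  ultimately show ?thesis unfolding mem_Per_eta_iff[OF gint s] by blast
qed

lemma nonzero_ideal_ideal_Inter:
  fixes S :: "'k :: field_char_0 set set"
  assumes "finite S" and "\<And>\<bb>. \<bb> \<in> S \<Longrightarrow> nonzero_ideal \<O> \<bb>"
  shows "nonzero_ideal \<O> (ideal_Inter \<O> S)"
  using assms
proof (induction S)
  case empty
  have "ideal_Inter \<O> {} = (carrier \<O> :: 'k set)" by (simp add: ideal_Inter_def)
  moreover have "\<exists>x\<in>carrier \<O>. x \<noteq> (0 :: 'k)" by (intro bexI[of _ 1]) simp_all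
  ultimately show ?case using ring_of_integers.oneideal by (simp only: nonzero_ideal_iff)
next
  case (insert \<bb> S)
  let ?s = "ideal_Inter \<O> S"
  have s: "ideal ?s \<O>" "\<exists>x\<in>?s. x \<noteq> 0" and b: "ideal \<bb> \<O>" "\<exists>x\<in>\<bb>. x \<noteq> 0"
    using insert.IH insert.prems by (auto simp: nonzero_ideal_iff)
  obtain x y where xy: "x \<in> ?s" "y \<in> \<bb>" "x * y \<noteq> 0" using s(2) b(2) by auto
  have "x * y \<in> \<bb> \<inter> ?s"
    using ideal_mult[OF b(1) ideal_algebraic_int[OF s(1) xy(1)] xy(2)]
      ideal_mult_right[OF s(1) ideal_algebraic_int[OF b(1) xy(2)] xy(1)] by blast
  moreover have "ideal (\<bb> \<inter> ?s) \<O>" by (rule ring_of_integers.i_intersect[OF b(1) s(1)])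
  moreover have "ideal_Inter \<O> (insert \<bb> S) = \<bb> \<inter> ?s" by (auto simp: ideal_Inter_def)
  ultimately show ?case using xy(3) unfolding nonzero_ideal_iff by metis
qed

lemma saturated_filtration_mono:
  assumes "saturated_filtration R \<BB> \<SS>" and "1 \<le> i" "i \<le> j"
  shows "\<SS> i \<subseteq> \<SS> j"
  using assms(3,2)
proof (induction rule: dec_induct)
  case (step n)
  then have "\<SS> n \<subseteq> \<SS> (Suc n)" using assms(1) by (simp add: saturated_filtration_def)
  then show ?case using step by auto
qed simp

text \<open>
  Containment in \<open>\<dd>\<close> means divisibility by \<open>\<dd>\<close>, which produces the cofactors \<open>c n\<close>, and cancelling \<open>\<dd>\<close>
  from \<open>\<dd> (c m + c n) = b m + b n = \<dd>\<close> shows that they are coprime.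
\<close>

lemma D_ideals_if_pairwise_sum:
  fixes b :: "nat \<Rightarrow> 'k :: field_char_0 set"
  assumes nf: "number_field TYPE('k)" and \<dd>: "nonzero_ideal \<O> \<dd>"
    and b: "\<And>n. b n \<in> \<BB>" "\<And>n. ideal (b n) \<O>" "inj b"
    and sum: "\<And>m n. m < n \<Longrightarrow> b m <+>\<^bsub>\<O>\<^esub> b n = \<dd>"
  shows "\<dd> \<in> D_ideals \<O> \<BB>"
proof -
  have d: "ideal \<dd> \<O>" using \<dd> by (simp add: nonzero_ideal_iff)
  have "b n \<subseteq> \<dd>" for n using ideal_sum_upper(1)[OF b(2) b(2), of n "Suc n"] sum[of n "Suc n"] by simp
  then have "\<forall>n. \<exists>\<cc>. ideal \<cc> \<O> \<and> \<dd> \<cdot>\<^bsub>\<O>\<^esub> \<cc> = b n"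
    using ideal_contains_imp_divides[OF nf \<dd> b(2)] by blast
  then obtain c where c: "\<And>n. ideal (c n) \<O>" "\<And>n. \<dd> \<cdot>\<^bsub>\<O>\<^esub> c n = b n" by metis
  have inj: "inj c"
  proof (rule injI)
    fix m n assume "c m = c n"
    then have "b m = b n" using c(2)[of m] c(2)[of n] by simp
    then show "m = n" by (rule injD[OF b(3)])
  qed
  have lt: "c m <+>\<^bsub>\<O>\<^esub> c n = carrier \<O>" if "m < n" for m n
  proof (rule ideal_prod_cancel[OF nf \<dd> ring_of_integers.add_ideals[OF c(1) c(1)] ring_of_integers.oneideal])
    show "\<dd> \<cdot>\<^bsub>\<O>\<^esub> (c m <+>\<^bsub>\<O>\<^esub> c n) = \<dd> \<cdot>\<^bsub>\<O>\<^esub> carrier \<O>"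
      unfolding ring_of_integers.ideal_prod_r_distr[OF d c(1) c(1)] c(2) sum[OF that]
        ring_of_integers.ideal_prod_one[OF d] ..
  qed
  have ne: "c m <+>\<^bsub>\<O>\<^esub> c n = carrier \<O>" if "m \<noteq> n" for m n
  proof (cases "m < n")
    case False
    then have "c n <+>\<^bsub>\<O>\<^esub> c m = carrier \<O>" using that by (intro lt) simp
    moreover have "c n \<subseteq> carrier \<O>" "c m \<subseteq> carrier \<O>" using ideal_algebraic_int[OF c(1)] by auto
    ultimately show ?thesis using ring_of_integers.set_add_comm by metis
  qed (rule lt)
  have "pairwise_coprime \<O> (range c)"
    unfolding pairwise_coprime_def pairwise_def by (auto intro!: ne)
  moreover have "infinite (range c)" using inj by (simp add: range_inj_infinite)
  moreover have "{\<dd> \<cdot>\<^bsub>\<O>\<^esub> \<cc> | \<cc>. \<cc> \<in> range c} \<subseteq> \<BB>" using c(2) b(1) by auto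
  moreover have "\<forall>\<cc>\<in>range c. ideal \<cc> \<O>" using c(1) by blast
  ultimately show ?thesis using \<dd> unfolding D_ideals_def by blast
qed

text \<open>
  Let \<open>s i\<close> be the intersection of \<open>\<SS> i\<close>. If \<open>g\<close> is in no \<open>Per\<close>-set of the \<open>s i\<close>, then \<open>g\<close> is
  free, because a member of \<open>\<BB>\<close> containing \<open>g\<close> would contain some \<open>s i\<close>. So for every \<open>i\<close> a translate
  of \<open>g\<close> by an element of \<open>s i\<close> lies in some \<open>b i\<close> from \<open>\<BB>\<close>, which cannot belong to \<open>\<SS> i\<close>. Then \<open>g\<close>
  lies in \<open>d i = b i + s i\<close>, and as only finitely many ideals contain \<open>g\<close>, infinitely many \<open>d i\<close> are
  equal to one ideal \<open>d k\<close>. If \<open>b i\<close> is in \<open>\<SS> j\<close> for two such indices, then \<open>s j \<subseteq> b i\<close> and hence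
  \<open>b i + b j = d k\<close>; passing to a sparse subsequence makes this true for all pairs.
\<close>

lemma nonperiodic_along_filtration:
  fixes \<BB> :: "'k :: field_char_0 set set"
  assumes nf: "number_field TYPE('k)" and \<BB>: "\<And>\<bb>. \<bb> \<in> \<BB> \<Longrightarrow> nonzero_ideal \<O> \<bb>"
    and \<SS>: "saturated_filtration \<O> \<BB> \<SS>"
    and g: "g \<in> carrier \<O>" "\<And>i. i \<ge> 1 \<Longrightarrow> g \<notin> Per \<O> (eta \<O> \<BB>) (ideal_Inter \<O> (\<SS> i))"
  shows "g \<in> multiples (D_ideals \<O> \<BB>) \<inter> free_elements \<O> \<BB>"
proof -
  define s where "s i = ideal_Inter \<O> (\<SS> i)" for i
  have sub: "\<SS> i \<subseteq> \<BB>" "finite (\<SS> i)" if "i \<ge> 1" for i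
    using \<SS> that by (auto simp: saturated_filtration_def saturated_def)
  have sI: "ideal (s i) \<O>" if "i \<ge> 1" for i
    using nonzero_ideal_ideal_Inter[of "\<SS> i"] sub[OF that] \<BB> by (auto simp: s_def nonzero_ideal_def)
  have bI: "ideal \<bb> \<O>" if "\<bb> \<in> \<BB>" for \<bb> using \<BB>[OF that] by (simp add: nonzero_ideal_def)
  have s_le: "s i \<subseteq> \<bb>" if "\<bb> \<in> \<SS> i" for i \<bb> using that by (auto simp: s_def ideal_Inter_def)
  have cover: "\<exists>i\<ge>1. \<bb> \<in> \<SS> i" if "\<bb> \<in> \<BB>" for \<bb>
    using \<SS> that by (auto simp: saturated_filtration_def)
  have nper: "\<exists>t\<in>s i. (g + t \<in> multiples \<BB>) \<noteq> (g \<in> multiples \<BB>)" if "i \<ge> 1" for i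
    using g(2)[OF that] mem_Per_eta_iff[OF g(1) sI[OF that]] by (auto simp: s_def)
  have free: "g \<notin> multiples \<BB>"
  proof
    assume gB: "g \<in> multiples \<BB>"
    then obtain \<bb> where b: "\<bb> \<in> \<BB>" "g \<in> \<bb>" by (auto simp: multiples_def)
    then obtain i where i: "i \<ge> 1" "\<bb> \<in> \<SS> i" using cover by blast
    obtain t where "t \<in> s i" "g + t \<notin> multiples \<BB>" using nper[OF i(1)] gB by auto
    then show False
      using ideal_add[OF bI[OF b(1)] b(2)] s_le[OF i(2)] b(1) by (auto simp: multiples_def)
  qed
  have "\<forall>i\<in>{1..}. \<exists>\<bb> t. \<bb> \<in> \<BB> \<and> t \<in> s i \<and> g + t \<in> \<bb>"
    using nper free by (fastforce simp: multiples_def)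
  then obtain b t where b: "\<And>i. i \<ge> 1 \<Longrightarrow> b i \<in> \<BB>" "\<And>i. i \<ge> 1 \<Longrightarrow> t i \<in> s i"
    "\<And>i. i \<ge> 1 \<Longrightarrow> g + t i \<in> b i" by (metis atLeast_iff)
  have notin: "b i \<notin> \<SS> i" if i: "i \<ge> 1" for i
  proof
    assume "b i \<in> \<SS> i"
    then have "g + t i - t i \<in> b i" using s_le b(2,3)[OF i] ideal_diff[OF bI[OF b(1)[OF i]]] by blast
    then show False using free b(1)[OF i] by (auto simp: multiples_def)
  qed
  \<comment> \<open>Zero lies in every ideal, in particular in \<open>b 1\<close>.\<close>
  have "g \<noteq> 0" using free b(1)[of 1] ideal_zero[OF bI, of "b 1"] by (auto simp: multiples_def)
  define d where "d i = b i <+>\<^bsub>\<O>\<^esub> s i" for i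
  have dI: "ideal (d i) \<O>" and gd: "g \<in> d i" if i: "i \<ge> 1" for i
  proof -
    show "ideal (d i) \<O>" unfolding d_def by (rule ring_of_integers.add_ideals[OF bI[OF b(1)[OF i]] sI[OF i]])
    have "g = (g + t i) + - t i" by simp
    then show "g \<in> d i"
      unfolding d_def mem_ideal_sum using b(3)[OF i] ideal_uminus[OF sI[OF i] b(2)[OF i]] by blast
  qed
  have "finite {I. ideal I \<O> \<and> g \<in> I}"
    using g(1) \<open>g \<noteq> 0\<close> by (intro finite_ideals_containing[OF nf]) simp_all
  then have "finite (d ` {1..})" by (rule finite_subset[rotated]) (use dI gd in auto)
  then obtain k where k: "k \<ge> 1" "infinite {i\<in>{1..}. d i = d k}"
    using pigeonhole_infinite[of "{1..}" d] infinite_Ici by auto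
  define X where "X = {i. i \<ge> 1 \<and> d i = d k}"
  have X: "infinite X" using k(2) by (simp add: X_def)
  \<comment> \<open>Every \<open>b (\<phi> n)\<close> is absorbed by the filtration before the next index is chosen.\<close>
  have "\<exists>\<phi>. \<forall>n. \<phi> n \<in> X \<and> (\<phi> n < \<phi> (Suc n) \<and> b (\<phi> n) \<in> \<SS> (\<phi> (Suc n)))"
  proof (rule dependent_nat_choice)
    show "\<exists>x. x \<in> X" using X by (metis finite.emptyI equals0I)
    fix x n :: nat assume x: "x \<in> X"
    then obtain i where i: "i \<ge> 1" "b x \<in> \<SS> i" using cover[OF b(1)] by (auto simp: X_def)
    obtain y where y: "y \<in> X" "y > max x i" using X unfolding infinite_nat_iff_unbounded by blast
    then have "b x \<in> \<SS> y" using saturated_filtration_mono[OF \<SS> i(1), of y] i(2) by auto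
    then show "\<exists>y. y \<in> X \<and> (x < y \<and> b x \<in> \<SS> y)" using y by auto
  qed
  then obtain \<phi> where \<phi>: "\<And>n. \<phi> n \<in> X" "\<And>n. \<phi> n < \<phi> (Suc n)" "\<And>n. b (\<phi> n) \<in> \<SS> (\<phi> (Suc n))"
    by blast
  have \<phi>1: "\<phi> n \<ge> 1" "d (\<phi> n) = d k" for n using \<phi>(1)[of n] by (auto simp: X_def)
  have mono: "strict_mono \<phi>" using \<phi>(2) by (simp add: strict_mono_Suc_iff)
  have later: "b (\<phi> m) \<in> \<SS> (\<phi> n)" if "m < n" for m n
  proof -
    have "\<phi> (Suc m) \<le> \<phi> n" using mono that by (simp add: strict_mono_less_eq)
    then show ?thesis using saturated_filtration_mono[OF \<SS> \<phi>1(1)] \<phi>(3)[of m] by blast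
  qed
  have "d k \<in> D_ideals \<O> \<BB>"
  proof (rule D_ideals_if_pairwise_sum[OF nf, of _ "\<lambda>n. b (\<phi> n)"])
    show "nonzero_ideal \<O> (d k)" using dI gd k(1) \<open>g \<noteq> 0\<close> by (auto simp: nonzero_ideal_iff)
    show "b (\<phi> n) \<in> \<BB>" "ideal (b (\<phi> n)) \<O>" for n using b(1) bI \<phi>1(1) by blast+
    have "b (\<phi> m) \<noteq> b (\<phi> n)" if "m < n" for m n
      using later[OF that] notin[OF \<phi>1(1)] by metis
    then show "inj (\<lambda>n. b (\<phi> n))" by (intro linorder_injI) blast
    show "b (\<phi> m) <+>\<^bsub>\<O>\<^esub> b (\<phi> n) = d k" if "m < n" for m n
    proof
      have bm: "ideal (b (\<phi> m)) \<O>" "ideal (b (\<phi> n)) \<O>" using b(1) bI \<phi>1(1) by blast+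
      have up: "b (\<phi> j) \<subseteq> d k" for j
        using ideal_sum_upper(1)[OF bI[OF b(1)[OF \<phi>1(1)]] sI[OF \<phi>1(1)], of j j] \<phi>1(2)[of j] by (simp add: d_def)
      show "b (\<phi> m) <+>\<^bsub>\<O>\<^esub> b (\<phi> n) \<subseteq> d k" by (rule ideal_sum_least[OF dI[OF k(1)] up up])
      have "b (\<phi> n) <+>\<^bsub>\<O>\<^esub> s (\<phi> n) \<subseteq> b (\<phi> m) <+>\<^bsub>\<O>\<^esub> b (\<phi> n)"
        using ideal_sum_upper[OF bm] s_le[OF later[OF that]]
        by (intro ideal_sum_least[OF ring_of_integers.add_ideals[OF bm]]) blast+
      then show "d k \<subseteq> b (\<phi> m) <+>\<^bsub>\<O>\<^esub> b (\<phi> n)" using \<phi>1(2)[of n] by (simp add: d_def)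
    qed
  qed
  then show ?thesis using gd[OF k(1)] g(1) free by (auto simp: multiples_def free_elements_def)
qed

theorem proposition4:
  fixes \<BB> :: "'k :: field_char_0 set set" and \<SS> :: "nat \<Rightarrow> 'k set set"
  assumes "number_field TYPE('k)"
    and "\<And>\<bb>. \<bb> \<in> \<BB> \<Longrightarrow> nonzero_ideal \<O> \<bb>"
    and "primitive \<BB>"
    and "saturated_filtration \<O> \<BB> \<SS>"
  shows "carrier \<O> - (\<Union>\<ss>\<in>{\<ss>. nonzero_ideal \<O> \<ss>}. Per \<O> (eta \<O> \<BB>) \<ss>)
           = multiples (D_ideals \<O> \<BB>) \<inter> free_elements \<O> \<BB>
       \<and> multiples (D_ideals \<O> \<BB>) \<inter> free_elements \<O> \<BB>
           = carrier \<O> - (\<Union>i\<in>{1..}. Per \<O> (eta \<O> \<BB>) (ideal_Inter \<O> (\<SS> i)))"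
proof -
  let ?A = "carrier \<O> - (\<Union>\<ss>\<in>{\<ss>. nonzero_ideal \<O> \<ss>}. Per \<O> (eta \<O> \<BB>) \<ss>)"
  let ?M = "multiples (D_ideals \<O> \<BB>) \<inter> free_elements \<O> \<BB>"
  let ?S = "carrier \<O> - (\<Union>i\<in>{1..}. Per \<O> (eta \<O> \<BB>) (ideal_Inter \<O> (\<SS> i)))"
  have "nonzero_ideal \<O> (ideal_Inter \<O> (\<SS> i))" if "i \<ge> 1" for i
    using assms(2,4) that
    by (intro nonzero_ideal_ideal_Inter) (auto simp: saturated_filtration_def saturated_def)
  then have AS: "?A \<subseteq> ?S" by auto
  have SM: "?S \<subseteq> ?M" using nonperiodic_along_filtration[OF assms(1,2,4)] by blast
  have MA: "?M \<subseteq> ?A"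
    using not_period_of_D_multiple[OF assms(1)] by (auto simp: free_elements_def)
  show ?thesis
    by (intro conjI equalityI subset_trans[OF AS SM] subset_trans[OF MA AS] SM MA)
qed

end
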